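(* Let $X$ be a locally compact Hausdorff space, $\mathcal{A}$ a unital $C^*$-algebra, and $\mathcal{E}$ a $*$-subalgebra of $C_0(X,\mathcal{A})$ such that: (AX0) if $X$ is noncompact, then for each $z\in X$ either $f_0(z)$ is invertible in $\mathcal{A}$ for some $f_0\in\mathcal{E}$, or $f(z)=0$ for all $f\in\mathcal{E}$; and for any two points $x,y\in X$ one of the following holds: (AX1) $x$ and $y$ are spectrally separated by $\mathcal{E}$; or (AX2) $M(f(x))=M(f(y))$ for every selfadjoint $f\in\mathcal{E}$. Then the uniform closure of $\mathcal{E}$ in $C_0(X,\mathcal{A})$ coincides with the $*$-algebra $\Delta_2(\mathcal{E})$ of all $u\in C_0(X,\mathcal{A})$ such that for any $x,y\in X$ and each $\varepsilon>0$ there is $v\in\mathcal{E}$ with $\|v(z)-u(z)\|<\varepsilon$ for $z\in\{x,y\}$.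
   Context: $C_0(X,\mathcal{A})$ denotes the $C^*$-algebra (pointwise operations, supremum norm) of continuous $f\colon X\to\mathcal{A}$ vanishing at infinity (for every $\varepsilon>0$ there is a compact $K$ with $\|f(x)\|<\varepsilon$ off $K$). For a selfadjoint $a\in\mathcal{A}$, $M(a)=\max\sigma(a)$. A collection $\mathcal{F}$ of functions $X\to\mathcal{A}$ spectrally separates distinct points $x,y$ if there is $f\in\mathcal{F}$ such that $f(x),f(y)$ are normal and $\sigma(f(x))\cap\sigma(f(y))=\emptyset$. *)

theory Defs
  imports "HOL-Analysis.Analysis"
begin

class complex_banach_algebra_1 = real_normed_algebra_1 + banach +
  fixes scaleC :: "complex \<Rightarrow> 'a \<Rightarrow> 'a" (infixr \<open>*\<^sub>C\<close> 75)
  assumes scaleC_add_right: "c *\<^sub>C (x + y) = c *\<^sub>C x + c *\<^sub>C y"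
    and scaleC_add_left: "(c + d) *\<^sub>C x = c *\<^sub>C x + d *\<^sub>C x"
    and scaleC_scaleC: "c *\<^sub>C (d *\<^sub>C x) = (c * d) *\<^sub>C x"
    and scaleC_one: "1 *\<^sub>C x = x"
    and scaleR_scaleC: "r *\<^sub>R x = complex_of_real r *\<^sub>C x"
    and norm_scaleC: "norm (c *\<^sub>C x) = cmod c * norm x"
    and mult_scaleC_left: "(c *\<^sub>C x) * y = c *\<^sub>C (x * y)"
    and mult_scaleC_right: "x * (c *\<^sub>C y) = c *\<^sub>C (x * y)"

definition cstar_involution :: "('a::complex_banach_algebra_1 \<Rightarrow> 'a) \<Rightarrow> bool" where
  "cstar_involution st \<longleftrightarrow>
     (\<forall>a b. st (a + b) = st a + st b) \<and>
     (\<forall>(c::complex) a. st (c *\<^sub>C a) = cnj c *\<^sub>C st a) \<and>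
     (\<forall>a b. st (a * b) = st b * st a) \<and>
     (\<forall>a. st (st a) = a) \<and>
     (\<forall>a. norm (st a * a) = norm a ^ 2)"

definition invertible_el :: "'a::ring_1 \<Rightarrow> bool" where
  "invertible_el a \<longleftrightarrow> (\<exists>b. a * b = 1 \<and> b * a = 1)"

definition spec :: "'a::complex_banach_algebra_1 \<Rightarrow> complex set" where
  "spec a = {l. \<not> invertible_el (a - l *\<^sub>C 1)}"

definition normal_el :: "('a \<Rightarrow> 'a) \<Rightarrow> 'a::complex_banach_algebra_1 \<Rightarrow> bool" where
  "normal_el st a \<longleftrightarrow> st a * a = a * st a"

text \<open>M(a) = max of the (real) spec of a selfadjoint element.\<close>
definition Mspec :: "'a::complex_banach_algebra_1 \<Rightarrow> real" where
  "Mspec a = Sup (Re ` spec a)"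

definition C0 :: "('x::topological_space \<Rightarrow> 'a::real_normed_vector) set" where
  "C0 = {f. continuous_on UNIV f \<and>
            (\<forall>\<epsilon>>0. \<exists>K. compact K \<and> (\<forall>x. x \<notin> K \<longrightarrow> norm (f x) < \<epsilon>))}"

definition star_subalgebra ::
  "('a \<Rightarrow> 'a) \<Rightarrow> ('x::topological_space \<Rightarrow> 'a::complex_banach_algebra_1) set \<Rightarrow> bool" where
  "star_subalgebra st E \<longleftrightarrow> E \<subseteq> C0 \<and> (\<lambda>_. 0) \<in> E \<and>
     (\<forall>f\<in>E. \<forall>g\<in>E. (\<lambda>x. f x + g x) \<in> E \<and> (\<lambda>x. f x * g x) \<in> E) \<and>
     (\<forall>f\<in>E. \<forall>c::complex. (\<lambda>x. c *\<^sub>C f x) \<in> E) \<and>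
     (\<forall>f\<in>E. (\<lambda>x. st (f x)) \<in> E)"

definition spectrally_separates ::
  "('a \<Rightarrow> 'a) \<Rightarrow> ('x \<Rightarrow> 'a::complex_banach_algebra_1) set \<Rightarrow> 'x \<Rightarrow> 'x \<Rightarrow> bool" where
  "spectrally_separates st F x y \<longleftrightarrow>
     (\<exists>f\<in>F. normal_el st (f x) \<and> normal_el st (f y) \<and> spec (f x) \<inter> spec (f y) = {})"

definition uniform_closure :: "('x::topological_space \<Rightarrow> 'a::real_normed_vector) set \<Rightarrow> ('x \<Rightarrow> 'a) set" where
  "uniform_closure E = {u \<in> C0. \<forall>\<epsilon>>0. \<exists>v\<in>E. (SUP x. norm (v x - u x)) < \<epsilon>}"

definition Delta2 :: "('x::topological_space \<Rightarrow> 'a::real_normed_vector) set \<Rightarrow> ('x \<Rightarrow> 'a) set" where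
  "Delta2 E = {u \<in> C0. \<forall>x y. \<forall>\<epsilon>>0. \<exists>v\<in>E. norm (v x - u x) < \<epsilon> \<and> norm (v y - u y) < \<epsilon>}"

end

theory Submission
  imports Defs "HOL-Computational_Algebra.Fundamental_Theorem_Algebra"
begin

text \<open>Call \<open>x\<close> and \<open>y\<close> equivalent if all elements of \<open>E\<close> have the same norm at \<open>x\<close> as at \<open>y\<close> and either both
  or neither of the points is degenerate, meaning that \<open>f x\<close> is never invertible; (AX2) forces this.
  If \<open>f x\<close> and \<open>f y\<close> have disjoint spectra, a Gelfand--Mazur argument modulo an ideal (no characters,
  only Rickart's averaging over roots of unity) puts \<open>(1, 0)\<close> in the closed unital algebra generated by the pairs
  \<open>(g x, g y)\<close>. So inequivalent points with \<open>x\<close> nondegenerate are separated by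
  some \<open>h \<in> E\<close> with \<open>h x\<close> near \<open>1\<close> and \<open>h y\<close> near \<open>0\<close>. Polynomials in selfadjoint elements sharpen these
  values, and products glue them over compact sets without any commutativity. Layered averages then show that
  scalar functions that are constant on equivalence classes lie in the closure of \<open>E\<close>; being central,
  they serve as a partition of unity that glues local approximations of an element of \<open>Delta2 E\<close>,
  for which the distance to an element of \<open>E\<close> is constant on equivalence classes. All degenerate points
  are equivalent, and off the compact case \<open>E\<close> vanishes there by (AX0), so one initial correction by an
  element of \<open>E\<close> takes care of them.\<close>

section \<open>Seminormed subalgebras and Rickart's argument\<close>

text \<open>Two obstacles shape the argument. And \<open>E\<close> need not contain the constants,
  so \<open>1 - h\<close> cannot be used to turn an element near \<open>1\<close> into one near
  \<open>0\<close>. Hence every polynomial applied inside \<open>E\<close> has zero constant term,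
  separation of \<open>x\<close> from \<open>y\<close> is a directed notion, and a point admits
  values near \<open>1\<close> only if some element of \<open>E\<close> is invertible there. Norms
  replace \<open>Mspec\<close>, through \<open>Mspec (a * a) = norm a ^ 2\<close> for selfadjoint
  \<open>a\<close>, because \<open>norm (f x)\<close> is a continuous scalar function of
  \<open>x\<close>, so bump functions built from it are constant on classes, and because equality of
  norms survives the passage to differences \<open>v - u\<close> with \<open>u\<close> in
  \<open>Delta2 E\<close>. One analytic fact, the decay of \<open>a^(2^k)\<close> when
  \<open>1 - l a\<close> is invertible on a disc, yields both that the norm of a selfadjoint element
  is attained on its spectrum and the Gelfand-Mazur theorem in a quotient that need not be
  complete.\<close>

lemma scaleC_zero_left [simp]: "(0::complex) *\<^sub>C (x::'a::complex_banach_algebra_1) = 0"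
  using scaleC_add_left[of 0 0 x] by simp

lemma scaleC_zero_right [simp]: "c *\<^sub>C (0::'a::complex_banach_algebra_1) = 0"
  using scaleC_add_right[of c 0 0] by simp

lemma scaleC_minus_left: "(- c) *\<^sub>C (x::'a::complex_banach_algebra_1) = - (c *\<^sub>C x)"
  using scaleC_add_left[of "-c" c x] by (simp add: eq_neg_iff_add_eq_0)

lemma scaleC_minus_right: "c *\<^sub>C (- x::'a::complex_banach_algebra_1) = - (c *\<^sub>C x)"
  using scaleC_add_right[of c "-x" x] by (simp add: eq_neg_iff_add_eq_0)

lemma scaleC_diff_left: "(c - d) *\<^sub>C (x::'a::complex_banach_algebra_1) = c *\<^sub>C x - d *\<^sub>C x"
  using scaleC_add_left[of c "-d" x] by (simp add: scaleC_minus_left)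

lemma scaleC_diff_right: "c *\<^sub>C (x - y::'a::complex_banach_algebra_1) = c *\<^sub>C x - c *\<^sub>C y"
  using scaleC_add_right[of c x "-y"] by (simp add: scaleC_minus_right)

lemma scaleC_minus_one: "(-1) *\<^sub>C (x::'a::complex_banach_algebra_1) = - x"
  by (simp add: scaleC_minus_left scaleC_one)

lemma scaleC_power: "(c *\<^sub>C (x::'a::complex_banach_algebra_1)) ^ n = (c ^ n) *\<^sub>C x ^ n"
  by (induction n) (auto simp: scaleC_one mult_scaleC_left mult_scaleC_right scaleC_scaleC mult.commute)

lemma bounded_bilinear_scaleC:
  "bounded_bilinear (scaleC :: complex \<Rightarrow> 'a::complex_banach_algebra_1 \<Rightarrow> 'a)"
proof
  fix c d :: complex and x y :: 'a and r :: real
  show "(c + d) *\<^sub>C x = c *\<^sub>C x + d *\<^sub>C x" by (rule scaleC_add_left)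
  show "c *\<^sub>C (x + y) = c *\<^sub>C x + c *\<^sub>C y" by (rule scaleC_add_right)
  show "(r *\<^sub>R c) *\<^sub>C x = r *\<^sub>R (c *\<^sub>C x)"
    by (simp add: scaleR_scaleC scaleC_scaleC scaleR_conv_of_real)
  show "c *\<^sub>C (r *\<^sub>R x) = r *\<^sub>R (c *\<^sub>C x)"
    by (simp add: scaleR_scaleC scaleC_scaleC mult.commute)
  show "\<exists>K. \<forall>(c::complex) (x::'a). norm (c *\<^sub>C x) \<le> norm c * norm x * K"
    by (rule exI[of _ 1]) (simp add: norm_scaleC)
qed

lemmas tendsto_scaleC = bounded_bilinear.tendsto[OF bounded_bilinear_scaleC]

text \<open>Stands for the normed algebra obtained from \<open>D\<close> by dividing out the null
  space of \<open>q\<close>, without forming the quotient. It is instantiated with the norm itself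
  and with the distance to an ideal. In the second case completeness is not at hand, hence no
  Neumann series; and \<open>q 1 \<le> 1\<close> leaves room for \<open>q 1 = 0\<close>, the
  collapse that \<open>gelfand_mazur\<close> establishes.\<close>

locale seminormed_subalgebra =
  fixes D :: "'a::complex_banach_algebra_1 set" and q :: "'a \<Rightarrow> real"
  assumes one_mem: "1 \<in> D"
    and add_mem: "\<And>x y. x \<in> D \<Longrightarrow> y \<in> D \<Longrightarrow> x + y \<in> D"
    and mult_mem: "\<And>x y. x \<in> D \<Longrightarrow> y \<in> D \<Longrightarrow> x * y \<in> D"
    and scaleC_mem: "\<And>c x. x \<in> D \<Longrightarrow> c *\<^sub>C x \<in> D"
    and q_nonneg: "\<And>x. q x \<ge> 0"
    and q_add: "\<And>x y. x \<in> D \<Longrightarrow> y \<in> D \<Longrightarrow> q (x + y) \<le> q x + q y"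
    and q_mult: "\<And>x y. x \<in> D \<Longrightarrow> y \<in> D \<Longrightarrow> q (x * y) \<le> q x * q y"
    and q_scaleC: "\<And>c x. x \<in> D \<Longrightarrow> q (c *\<^sub>C x) = cmod c * q x"
    and q_one: "q 1 \<le> 1"
begin

lemma zero_mem: "0 \<in> D"
  using scaleC_mem[OF one_mem, of 0] by simp

lemma minus_mem: "x \<in> D \<Longrightarrow> - x \<in> D"
  using scaleC_mem[of x "-1"] by (simp add: scaleC_minus_one)

lemma diff_mem: "x \<in> D \<Longrightarrow> y \<in> D \<Longrightarrow> x - y \<in> D"
  using add_mem[of x "-y"] minus_mem[of y] by simp

lemma power_mem: "x \<in> D \<Longrightarrow> x ^ n \<in> D"
  by (induction n) (auto simp: one_mem mult_mem)

lemmas mems = one_mem add_mem mult_mem scaleC_mem zero_mem minus_mem diff_mem power_mem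

lemma q_minus: "x \<in> D \<Longrightarrow> q (- x) = q x"
  using q_scaleC[of x "-1"] by (simp add: scaleC_minus_one)

lemma q_diff: "x \<in> D \<Longrightarrow> y \<in> D \<Longrightarrow> q (x - y) \<le> q x + q y"
  using q_add[of x "-y"] by (simp add: minus_mem q_minus)

lemma q_diff_commute: "x \<in> D \<Longrightarrow> y \<in> D \<Longrightarrow> q (x - y) = q (y - x)"
  using q_minus[of "x - y"] by (simp add: diff_mem)

lemma q_zero: "q 0 = 0"
  using q_scaleC[OF one_mem, of 0] by simp

lemma q_mult_le:
  assumes "x \<in> D" "y \<in> D" "q x \<le> b" "q y \<le> c"
  shows "q (x * y) \<le> b * c"
proof -
  have "q x * q y \<le> b * c"
    using assms q_nonneg by (meson mult_mono order_trans)
  then show ?thesis using q_mult[of x y] assms by linarith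
qed

lemma q_power: "x \<in> D \<Longrightarrow> q (x ^ n) \<le> q x ^ n"
proof (induction n)
  case 0
  then show ?case using q_one by simp
next
  case (Suc n)
  then show ?case using q_mult_le[of x "x ^ n" "q x" "q x ^ n"] by (simp add: mems)
qed

definition eqq :: "'a \<Rightarrow> 'a \<Rightarrow> bool" (infix \<open>\<simeq>\<close> 50) where
  "x \<simeq> y \<longleftrightarrow> x \<in> D \<and> y \<in> D \<and> q (x - y) = 0"

lemma eqq_refl: "x \<in> D \<Longrightarrow> x \<simeq> x"
  by (simp add: eqq_def q_zero)

lemma eqq_sym: "x \<simeq> y \<Longrightarrow> y \<simeq> x"
  by (simp add: eqq_def q_diff_commute)

lemma eqq_add: assumes "x \<simeq> y" "x' \<simeq> y'" shows "x + x' \<simeq> y + y'"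
proof -
  have "q ((x + x') - (y + y')) \<le> q (x - y) + q (x' - y')"
    using q_add[of "x - y" "x' - y'"] assms by (simp add: eqq_def mems algebra_simps)
  then show ?thesis using assms q_nonneg[of "(x + x') - (y + y')"]
    by (auto simp: eqq_def mems)
qed

lemma eqq_scaleC: "x \<simeq> y \<Longrightarrow> c *\<^sub>C x \<simeq> c *\<^sub>C y"
  using q_scaleC[of "x - y" c] by (auto simp: eqq_def mems scaleC_diff_right)

lemma eqq_diff: "x \<simeq> y \<Longrightarrow> x' \<simeq> y' \<Longrightarrow> x - x' \<simeq> y - y'"
  using eqq_add[of x y "-x'" "-y'"] eqq_scaleC[of x' y' "-1"] by (simp add: scaleC_minus_one)

lemma eqq_trans: assumes "x \<simeq> y" "y \<simeq> z" shows "x \<simeq> z"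
  using eqq_add[OF assms] eqq_diff[of "x + y" "y + z" y y] eqq_refl[of y] assms
  by (simp add: eqq_def)

lemma eqq_mult_left: assumes "x \<simeq> y" "z \<in> D" shows "z * x \<simeq> z * y"
proof -
  have "q (z * x - z * y) \<le> q z * q (x - y)"
    using q_mult[of z "x - y"] assms by (simp add: eqq_def mems algebra_simps)
  then show ?thesis using assms q_nonneg[of "z * x - z * y"]
    by (auto simp: eqq_def mems)
qed

lemma eqq_mult_right: assumes "x \<simeq> y" "z \<in> D" shows "x * z \<simeq> y * z"
proof -
  have "q (x * z - y * z) \<le> q (x - y) * q z"
    using q_mult[of "x - y" z] assms by (simp add: eqq_def mems algebra_simps)
  then show ?thesis using assms q_nonneg[of "x * z - y * z"]
    by (auto simp: eqq_def mems)
qed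

lemma eqq_q: assumes "x \<simeq> y" shows "q x = q y"
proof -
  have "q x \<le> q (x - y) + q y" using q_add[of "x - y" y] assms by (simp add: eqq_def mems)
  moreover have "q y \<le> q (y - x) + q x" using q_add[of "y - x" x] assms by (simp add: eqq_def mems)
  ultimately show ?thesis using assms q_diff_commute[of x y] by (auto simp: eqq_def)
qed

definition is_inv :: "'a \<Rightarrow> 'a \<Rightarrow> bool" where
  "is_inv x s \<longleftrightarrow> x \<in> D \<and> s \<in> D \<and> x * s \<simeq> 1 \<and> s * x \<simeq> 1"

text \<open>Partial fractions: \<open>1/(1 - b^2)\<close> is the mean of \<open>1/(1 - b)\<close>
  and \<open>1/(1 + b)\<close>. Applied to \<open>b = (l a)^(2^k)\<close>, this doubles the
  exponent.\<close>

lemma is_inv_average: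
  assumes "is_inv (1 - b) s" "is_inv (1 + b) t" "b \<in> D"
  shows "is_inv (1 - b * b) ((1/2) *\<^sub>C (s + t))"
proof -
  have D: "s \<in> D" "t \<in> D" using assms by (auto simp: is_inv_def)
  have half: "(1/2) *\<^sub>C ((1 + b) + (1 - b)) = (1::'a)"
  proof -
    have "(1 + b) + (1 - b) = (2::complex) *\<^sub>C (1::'a)"
      using scaleC_add_left[of 1 1 "1::'a"] by (simp add: scaleC_one)
    then show ?thesis by (simp only: scaleC_scaleC) (simp add: scaleC_one)
  qed
  have f1: "1 - b * b = (1 + b) * (1 - b)" "1 - b * b = (1 - b) * (1 + b)"
    by (simp_all add: algebra_simps)
  have "(1 - b * b) * s \<simeq> 1 + b"
    using eqq_mult_left[of "(1 - b) * s" 1 "1 + b"] assms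
    by (simp add: f1(1) is_inv_def mems mult.assoc)
  moreover have "(1 - b * b) * t \<simeq> 1 - b"
    using eqq_mult_left[of "(1 + b) * t" 1 "1 - b"] assms
    by (simp add: f1(2) is_inv_def mems mult.assoc)
  ultimately have "(1/2) *\<^sub>C ((1 - b * b) * s + (1 - b * b) * t) \<simeq> (1/2) *\<^sub>C ((1 + b) + (1 - b))"
    by (intro eqq_scaleC eqq_add)
  then have r: "(1 - b * b) * ((1/2) *\<^sub>C (s + t)) \<simeq> 1"
    by (simp only: half mult_scaleC_right distrib_left)
  have "s * (1 - b * b) \<simeq> 1 + b"
    using eqq_mult_right[of "s * (1 - b)" 1 "1 + b"] assms
    by (simp add: f1(2) is_inv_def mems mult.assoc)
  moreover have "t * (1 - b * b) \<simeq> 1 - b"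
    using eqq_mult_right[of "t * (1 + b)" 1 "1 - b"] assms
    by (simp add: f1(1) is_inv_def mems mult.assoc)
  ultimately have "(1/2) *\<^sub>C (s * (1 - b * b) + t * (1 - b * b)) \<simeq> (1/2) *\<^sub>C ((1 + b) + (1 - b))"
    by (intro eqq_scaleC eqq_add)
  then have l: "((1/2) *\<^sub>C (s + t)) * (1 - b * b) \<simeq> 1"
    by (simp only: half mult_scaleC_left distrib_right)
  show ?thesis using r l D assms(3) by (simp add: is_inv_def mems)
qed

lemma resolvent_identity:
  assumes "is_inv (1 - l *\<^sub>C a) s" "is_inv (1 - m *\<^sub>C a) t" "a \<in> D"
  shows "s - t \<simeq> (l - m) *\<^sub>C (s * a * t)"
proof -
  have D: "s \<in> D" "t \<in> D" using assms by (auto simp: is_inv_def)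
  have "s * ((1 - m *\<^sub>C a) * t) \<simeq> s * 1"
    using assms D by (intro eqq_mult_left) (auto simp: is_inv_def)
  moreover have "(s * (1 - l *\<^sub>C a)) * t \<simeq> 1 * t"
    using assms D by (intro eqq_mult_right) (auto simp: is_inv_def)
  ultimately have "s * ((1 - m *\<^sub>C a) * t) - (s * (1 - l *\<^sub>C a)) * t \<simeq> s - t"
    using eqq_diff by fastforce
  moreover have "s * ((1 - m *\<^sub>C a) * t) - (s * (1 - l *\<^sub>C a)) * t = (l - m) *\<^sub>C (s * a * t)"
    by (simp add: algebra_simps scaleC_diff_left mult_scaleC_left mult_scaleC_right)
  ultimately show ?thesis by (simp add: eqq_sym)
qed

lemma resolvent_diff_le:
  assumes "is_inv (1 - l *\<^sub>C a) s" "is_inv (1 - m *\<^sub>C a) t" "a \<in> D"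
  shows "q (s - t) \<le> cmod (l - m) * (q s * q a * q t)"
proof -
  have D: "s \<in> D" "t \<in> D" using assms by (auto simp: is_inv_def)
  have "q (s - t) = cmod (l - m) * q (s * a * t)"
    using eqq_q[OF resolvent_identity[OF assms]] q_scaleC[of "s * a * t"] D assms(3)
    by (simp add: mems)
  also have "\<dots> \<le> cmod (l - m) * (q s * q a * q t)"
    using D assms(3) by (intro mult_left_mono q_mult_le q_mult order_refl) (auto simp: mems)
  finally show ?thesis .
qed

text \<open>Compactness is applied to discs on which the resolvent at most doubles: the radius
  \<open>r l\<close> turns the resolvent estimate into
  \<open>q (R m) \<le> q (R l) + q (R m) / 2\<close>, and the last term is absorbed.\<close>

lemma resolvent_bounded:
  assumes a: "a \<in> D" and R: "\<And>l. cmod l \<le> T \<Longrightarrow> is_inv (1 - l *\<^sub>C a) (R l)"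
  shows "\<exists>M>0. \<forall>l. cmod l \<le> T \<longrightarrow> q (R l) \<le> M"
proof -
  define r where "r l = 1 / (2 * (q (R l) * q a + 1))" for l
  have rpos: "r l > 0" for l
    using q_nonneg[of "R l"] q_nonneg[of a]
    by (auto simp: r_def intro!: add_nonneg_pos mult_nonneg_nonneg)
  have loc: "q (R m) \<le> 2 * q (R l)"
    if lm: "cmod l \<le> T" "cmod m \<le> T" "m \<in> ball l (r l)" for l m
  proof -
    have qs: "q (R l) \<ge> 0" "q (R m) \<ge> 0" "q a \<ge> 0" by (auto simp: q_nonneg)
    have D: "R l \<in> D" "R m \<in> D" using R lm by (auto simp: is_inv_def)
    have "q (R m) \<le> q (R l) + q (R m - R l)"
      using q_add[of "R l" "R m - R l"] D by (simp add: mems)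
    also have "q (R m - R l) = q (R l - R m)" using q_diff_commute D by blast
    also have "\<dots> \<le> cmod (l - m) * (q (R l) * q a * q (R m))"
      by (rule resolvent_diff_le[OF R R a]) (use lm in auto)
    also have "\<dots> = (cmod (l - m) * (q (R l) * q a)) * q (R m)" by simp
    also have "\<dots> \<le> (1/2) * q (R m)"
    proof (rule mult_right_mono)
      have "cmod (l - m) * (q (R l) * q a) \<le> r l * (q (R l) * q a)"
        using lm qs by (intro mult_right_mono) (auto simp: dist_norm)
      also have "\<dots> \<le> 1/2"
        using qs by (auto simp: r_def field_simps add_pos_nonneg)
      finally show "cmod (l - m) * (q (R l) * q a) \<le> 1/2" .
    qed (use qs in auto)
    finally show ?thesis by simp
  qed
  have "compact (cball (0::complex) T)" by simp
  then obtain F where F: "F \<subseteq> cball 0 T" "finite F" "cball 0 T \<subseteq> (\<Union>l\<in>F. ball l (r l))"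
    by (rule compactE_image[of _ "cball 0 T" "\<lambda>l. ball l (r l)"])
      (use rpos in \<open>auto simp: centre_in_ball intro!: bexI\<close>)
  define M where "M = (\<Sum>l\<in>F. 2 * q (R l)) + 1"
  have Mpos: "M > 0" unfolding M_def by (intro add_nonneg_pos sum_nonneg) (auto simp: q_nonneg)
  have "q (R m) \<le> M" if m: "cmod m \<le> T" for m
  proof -
    obtain l where l: "l \<in> F" "m \<in> ball l (r l)" using F(3) m by auto
    have "q (R m) \<le> 2 * q (R l)" using loc[of l m] l F(1) m by auto
    also have "\<dots> \<le> (\<Sum>l\<in>F. 2 * q (R l))"
      using member_le_sum[OF l(1), of "\<lambda>l. 2 * q (R l)"] F(2) q_nonneg by simp
    finally show ?thesis by (simp add: M_def)
  qed
  with Mpos show ?thesis by auto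
qed

text \<open>Absorption replaces the Neumann series: \<open>s - 1\<close> equals \<open>b * s\<close>
  up to a null element, so \<open>q s \<le> 1 + q s / 2\<close> and hence
  \<open>q s \<le> 2\<close>.\<close>

lemma inverse_near_one:
  assumes "is_inv (1 - b) s" "b \<in> D" "q b \<le> 1/2"
  shows "q (s - 1) \<le> 2 * q b"
proof -
  have D: "s \<in> D" using assms by (auto simp: is_inv_def)
  have "(1 - b) * s \<simeq> 1" using assms by (simp add: is_inv_def)
  then have "(1 - b) * s + (b * s - 1) \<simeq> 1 + (b * s - 1)"
    using D assms by (intro eqq_add eqq_refl) (auto simp: mems)
  then have e: "s - 1 \<simeq> b * s" by (simp add: algebra_simps)
  have "q s \<le> q (s - 1) + q 1" using q_add[of "s - 1" 1] D by (simp add: mems)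
  moreover have m: "q (s - 1) \<le> q b * q s" using eqq_q[OF e] q_mult[of b s] D assms by simp
  moreover have "q b * q s \<le> (1/2) * q s" using assms(3) q_nonneg by (intro mult_right_mono) auto
  ultimately have "q s \<le> 2" using q_one by linarith
  then have "q b * q s \<le> q b * 2" using q_nonneg by (intro mult_left_mono) auto
  with m show ?thesis by simp
qed

text \<open>The way back from the inverse to the element: \<open>b\<close> agrees with
  \<open>(s - 1) - b * (s - 1)\<close>, so \<open>q b \<le> 1/3 + q b / 3\<close>.\<close>

lemma small_from_inverse_near_one:
  assumes "is_inv (1 - b) s" "b \<in> D" "q (s - 1) \<le> 1/3"
  shows "q b \<le> 1/2"
proof -
  have D: "s \<in> D" using assms by (auto simp: is_inv_def)
  have "(1 - b) * s \<simeq> 1" using assms by (simp add: is_inv_def)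
  then have "s - (1 - b) * s - b * (s - 1) \<simeq> s - 1 - b * (s - 1)"
    using D assms by (intro eqq_diff eqq_refl) (auto simp: mems)
  then have "b \<simeq> (s - 1) - b * (s - 1)" by (simp add: algebra_simps)
  then have "q b = q ((s - 1) - b * (s - 1))" by (rule eqq_q)
  also have "\<dots> \<le> q (s - 1) + q (b * (s - 1))" using D assms by (intro q_diff) (auto simp: mems)
  also have "q (b * (s - 1)) \<le> q b * (1/3)"
    using D assms by (intro q_mult_le) (auto simp: mems)
  finally show ?thesis using assms(3) by linarith
qed

text \<open>Rickart's argument: the averages \<open>G k l\<close> of the resolvent over the \<open>2^k\<close>-th roots of unity invert
  \<open>1 - (l a)^(2^k)\<close> and inherit the modulus of continuity of the resolvent uniformly in \<open>k\<close>.\<close>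

lemma dyadic_powers_tendsto_zero:
  assumes a: "a \<in> D" and T: "T > 0"
    and inv: "\<And>l. cmod l \<le> T \<Longrightarrow> \<exists>s. is_inv (1 - l *\<^sub>C a) s"
  shows "(\<lambda>k. T ^ (2 ^ k) * q (a ^ (2 ^ k))) \<longlonglongrightarrow> 0"
proof -
  obtain R where R: "\<And>l. cmod l \<le> T \<Longrightarrow> is_inv (1 - l *\<^sub>C a) (R l)" using inv by metis
  obtain M where M: "M > 0" "\<And>l. cmod l \<le> T \<Longrightarrow> q (R l) \<le> M"
    using resolvent_bounded[OF a R] by blast
  \<comment> \<open>A \<open>2^k\<close>-th root of \<open>-1\<close>: replacing \<open>l\<close> by
    \<open>l * \<omega> k\<close> changes the sign of \<open>(l a)^(2^k)\<close>, as
    \<open>is_inv_average\<close> requires.\<close>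
  define \<omega> where "\<omega> k = cis (pi / 2 ^ k)" for k :: nat
  have om: "cmod (\<omega> k) = 1" "\<omega> k ^ (2 ^ k) = -1" for k
    by (auto simp: \<omega>_def Complex.DeMoivre)
  define G where "G = rec_nat R (\<lambda>k g l. (1/2) *\<^sub>C (g l + g (l * \<omega> k)))"
  have G0: "G 0 l = R l" and GS: "G (Suc k) l = (1/2) *\<^sub>C (G k l + G k (l * \<omega> k))" for k l
    by (auto simp: G_def)
  have Ginv: "is_inv (1 - (l *\<^sub>C a) ^ (2 ^ k)) (G k l)" if "cmod l \<le> T" for k l
    using that
  proof (induction k arbitrary: l)
    case 0
    then show ?case by (simp add: G0 R)
  next
    case (Suc k)
    define b where "b = (l *\<^sub>C a) ^ (2 ^ k)"
    have bD: "b \<in> D" using a by (simp add: b_def mems)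
    have "((l * \<omega> k) *\<^sub>C a) ^ (2 ^ k) = - b"
      by (simp add: b_def scaleC_power power_mult_distrib om scaleC_minus_left)
    then have "is_inv (1 + b) (G k (l * \<omega> k))"
      using Suc.IH[of "l * \<omega> k"] Suc.prems by (simp add: norm_mult om)
    moreover have "is_inv (1 - b) (G k l)" using Suc.IH[of l] Suc.prems by (simp add: b_def)
    moreover have "b * b = (l *\<^sub>C a) ^ (2 ^ Suc k)"
      by (simp add: b_def power_add[symmetric] mult_2)
    ultimately show ?case using is_inv_average[of b] bD by (simp add: GS)
  qed
  \<comment> \<open>Chosen so that passing from \<open>l\<close> to \<open>\<rho> * l\<close> moves
    the resolvent by at most \<open>T * (1 - \<rho>) * (M * q a * M) \<le> 1/4\<close>.\<close>
  define \<rho> where "\<rho> = 1 - 1 / (4 * (T * (M * q a * M) + 1))"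
  have den: "T * (M * q a * M) \<ge> 0" using T M q_nonneg[of a] by simp
  have rho: "0 < \<rho>" "\<rho> < 1" using den by (auto simp: \<rho>_def field_simps add_pos_nonneg)
  have scaled: "cmod (of_real \<rho> * l) \<le> T" if "cmod l \<le> T" for l
  proof -
    have "\<rho> * cmod l \<le> 1 * cmod l" using rho by (intro mult_right_mono) auto
    then show ?thesis using that rho by (simp add: norm_mult)
  qed
  have close0: "q (R l - R (of_real \<rho> * l)) \<le> 1/4" if l: "cmod l \<le> T" for l
  proof -
    have "q (R l - R (of_real \<rho> * l)) \<le> cmod (l - of_real \<rho> * l) * (q (R l) * q a * q (R (of_real \<rho> * l)))"
      using R l scaled by (intro resolvent_diff_le a) auto
    also have "\<dots> \<le> (T * (1 - \<rho>)) * (M * q a * M)"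
    proof (intro mult_mono M l scaled)
      have "l - of_real \<rho> * l = of_real (1 - \<rho>) * l" by (simp add: algebra_simps)
      then have "cmod (l - of_real \<rho> * l) = (1 - \<rho>) * cmod l" using rho by (simp add: norm_mult del: of_real_diff)
      also have "\<dots> \<le> (1 - \<rho>) * T" using l rho by (intro mult_left_mono) auto
      finally show "cmod (l - of_real \<rho> * l) \<le> T * (1 - \<rho>)" by (simp add: mult.commute)
    qed (use q_nonneg M T rho in \<open>auto intro!: mult_nonneg_nonneg\<close>)
    also have "\<dots> = (T * (M * q a * M)) * (1 - \<rho>)" by simp
    also have "\<dots> \<le> 1/4" using den by (simp add: \<rho>_def field_simps add_pos_nonneg)
    finally show ?thesis .
  qed
  have close: "q (G k l - G k (of_real \<rho> * l)) \<le> 1/4" if "cmod l \<le> T" for k l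
    using that
  proof (induction k arbitrary: l)
    case 0
    show ?case using close0[OF 0] by (simp only: G0)
  next
    case (Suc k)
    let ?m = "of_real \<rho> * l"
    have c: "cmod (l * \<omega> k) \<le> T" "cmod ?m \<le> T" "cmod (?m * \<omega> k) \<le> T"
      using Suc.prems scaled[OF Suc.prems] by (auto simp: norm_mult om)
    have D: "G k l \<in> D" "G k ?m \<in> D" "G k (l * \<omega> k) \<in> D" "G k (?m * \<omega> k) \<in> D"
      using Ginv[of _ k] Suc.prems c unfolding is_inv_def by auto
    have "G (Suc k) l - G (Suc k) ?m
        = (1/2) *\<^sub>C ((G k l - G k ?m) + (G k (l * \<omega> k) - G k (?m * \<omega> k)))"
      by (simp add: GS scaleC_diff_right scaleC_add_right algebra_simps)
    then have "q (G (Suc k) l - G (Suc k) ?m)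
        = (1/2) * q ((G k l - G k ?m) + (G k (l * \<omega> k) - G k (?m * \<omega> k)))"
      using D q_scaleC by (simp add: mems)
    also have "\<dots> \<le> (1/2) * (q (G k l - G k ?m) + q (G k (l * \<omega> k) - G k (?m * \<omega> k)))"
      using D by (intro mult_left_mono q_add) (auto simp: mems)
    also have "\<dots> \<le> 1/4"
      using Suc.IH[OF Suc.prems] Suc.IH[OF c(1)] by (simp add: mult.assoc)
    finally show ?case .
  qed
  define x where "x t k = t ^ (2 ^ k) * q (a ^ (2 ^ k))" for t :: real and k :: nat
  have x_nonneg: "x t k \<ge> 0" if "t \<ge> 0" for t k using that q_nonneg by (simp add: x_def)
  have qpow: "q ((of_real t *\<^sub>C a) ^ (2 ^ k)) = x t k" if "t \<ge> 0" for t k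
    using that q_scaleC[of "a ^ (2 ^ k)" "of_real t ^ (2 ^ k)"] a
    by (simp add: scaleC_power x_def mems norm_power)
  \<comment> \<open>A single dyadic power of size at most \<open>1/2\<close> suffices: each further
    one is bounded by the square of its predecessor.\<close>
  have x_zero: "x t \<longlonglongrightarrow> 0" if t: "t \<ge> 0" and k: "x t k \<le> 1/2" for t k
  proof -
    have half: "x t (k + j) \<le> (1/2) ^ Suc j" for j
    proof (induction j)
      case 0
      then show ?case using k by simp
    next
      case (Suc j)
      have "x t (k + Suc j) \<le> x t (k + j) * x t (k + j)"
        using q_mult_le[of "(of_real t *\<^sub>C a) ^ (2 ^ (k + j))" "(of_real t *\<^sub>C a) ^ (2 ^ (k + j))"] a t
        by (simp add: qpow[symmetric] mems power_add[symmetric] mult_2)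
      also have "\<dots> \<le> (1/2) ^ Suc j * (1/2) ^ Suc j"
        using Suc.IH x_nonneg[OF t] by (intro mult_mono) auto
      also have "\<dots> \<le> (1/2) ^ Suc j * (1/2) ^ 1"
        by (intro mult_left_mono power_decreasing) auto
      finally show ?case by simp
    qed
    have "(\<lambda>j. (1/2::real) ^ Suc j) \<longlonglongrightarrow> 0"
      by (intro LIMSEQ_Suc LIMSEQ_realpow_zero) auto
    then have "(\<lambda>j. x t (j + k)) \<longlonglongrightarrow> 0"
      by (rule tendsto_sandwich[OF _ _ tendsto_const, rotated 2])
        (use half x_nonneg[OF t] in \<open>auto simp: add.commute\<close>)
    then show ?thesis by (rule LIMSEQ_offset)
  qed
  \<comment> \<open>The constants: a power below \<open>1/24\<close> at \<open>\<rho> * t\<close>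
    puts its inverse within \<open>1/12\<close> of \<open>1\<close>, the move from
    \<open>\<rho> * t\<close> to \<open>t\<close> costs \<open>1/4\<close>, and the total
    \<open>1/3\<close> brings the power at \<open>t\<close> down to at most
    \<open>1/2\<close>.\<close>
  have step: "x t \<longlonglongrightarrow> 0" if t: "0 \<le> t" "t \<le> T" and lim: "x (\<rho> * t) \<longlonglongrightarrow> 0" for t
  proof -
    have "eventually (\<lambda>k. x (\<rho> * t) k < 1/24) sequentially"
      using lim by (rule order_tendstoD) simp
    then obtain k where k: "x (\<rho> * t) k < 1/24" by (auto simp: eventually_sequentially)
    define b where "b = (of_real t *\<^sub>C a) ^ (2 ^ k)"
    define b' where "b' = (of_real (\<rho> * t) *\<^sub>C a) ^ (2 ^ k)"
    have D: "b \<in> D" "b' \<in> D" using a by (auto simp: b_def b'_def mems)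
    have ct: "cmod (of_real t) \<le> T" "cmod (of_real (\<rho> * t)) \<le> T"
      using t scaled[of "of_real t"] by auto
    have "is_inv (1 - b') (G k (of_real (\<rho> * t)))" unfolding b'_def by (rule Ginv[OF ct(2)])
    moreover have "q b' < 1/24" using k t rho by (simp add: b'_def qpow del: of_real_mult)
    ultimately have "q (G k (of_real (\<rho> * t)) - 1) \<le> 1/12"
      using inverse_near_one[of b'] D by fastforce
    moreover have "q (G k (of_real t) - G k (of_real (\<rho> * t))) \<le> 1/4" using close[OF ct(1)] by simp
    moreover have GD: "G k (of_real t) \<in> D" "G k (of_real (\<rho> * t)) \<in> D"
      using Ginv[OF ct(1)] Ginv[OF ct(2)] by (auto simp: is_inv_def)
    moreover have "q (G k (of_real t) - 1)
        \<le> q (G k (of_real t) - G k (of_real (\<rho> * t))) + q (G k (of_real (\<rho> * t)) - 1)"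
      using q_add[of "G k (of_real t) - G k (of_real (\<rho> * t))" "G k (of_real (\<rho> * t)) - 1"] GD
      by (simp add: mems)
    ultimately have "q (G k (of_real t) - 1) \<le> 1/3" by linarith
    then have "q b \<le> 1/2"
      using small_from_inverse_near_one[OF Ginv[OF ct(1), of k]] D by (simp add: b_def)
    then show ?thesis using x_zero[OF t(1)] qpow[OF t(1)] by (simp add: b_def)
  qed
  \<comment> \<open>The climb to \<open>T\<close> in \<open>m\<close> steps of ratio
    \<open>\<rho>\<close> starts at \<open>\<rho> ^ m * T\<close>, where already the power with
    \<open>k = 0\<close> is below \<open>1/2\<close>.\<close>
  have "(\<lambda>m. \<rho> ^ m * (T * q a)) \<longlonglongrightarrow> 0 * (T * q a)"
    using rho by (intro tendsto_mult LIMSEQ_realpow_zero tendsto_const) auto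
  then have "eventually (\<lambda>m. \<rho> ^ m * (T * q a) < 1/2) sequentially"
    by (intro order_tendstoD) auto
  then obtain m where m: "\<rho> ^ m * (T * q a) < 1/2" by (auto simp: eventually_sequentially)
  have base: "x (\<rho> ^ m * T) \<longlonglongrightarrow> 0"
    by (rule x_zero[of _ 0]) (use m T rho in \<open>auto simp: x_def mult.assoc\<close>)
  have "x (\<rho> ^ (m - j) * T) \<longlonglongrightarrow> 0" if "j \<le> m" for j
    using that
  proof (induction j)
    case 0
    then show ?case using base by simp
  next
    case (Suc j)
    then have "m - j = Suc (m - Suc j)" by simp
    then have lim: "x (\<rho> * (\<rho> ^ (m - Suc j) * T)) \<longlonglongrightarrow> 0"
      using Suc by (simp add: mult.assoc)
    have le: "\<rho> ^ (m - Suc j) * T \<le> 1 * T"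
      using rho T by (intro mult_right_mono power_le_one) auto
    show ?case by (rule step[OF _ _ lim]) (use rho T le in auto)
  qed
  from this[of m] have "x T \<longlonglongrightarrow> 0" by simp
  then show ?thesis unfolding x_def .
qed

text \<open>If all \<open>a - l\<close> are invertible, then so are all \<open>1 - l a\<close>, and
  \<open>T^n * q (a^n)\<close> tends to \<open>0\<close> along \<open>n = 2^k\<close> for every
  positive \<open>T\<close>. With \<open>s\<close> an inverse of \<open>a\<close>, the unit is
  \<open>a^n * s^n\<close> up to a null element, so \<open>q 1 \<le> q (a^n) * (q s)^n\<close>, and
  any \<open>T > q s\<close> forces \<open>q 1 = 0\<close>.\<close>

theorem gelfand_mazur:
  assumes a: "a \<in> D" and inv: "\<And>l. \<exists>s. is_inv (a - l *\<^sub>C 1) s"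
  shows "q 1 = 0"
proof -
  obtain s where s: "is_inv (a - 0 *\<^sub>C 1) s" using inv by blast
  then have sD: "s \<in> D" "a * s \<simeq> 1" by (auto simp: is_inv_def)
  define T where "T = q s + 1"
  have T: "T > 0" using q_nonneg[of s] by (simp add: T_def)
  have "\<exists>t. is_inv (1 - l *\<^sub>C a) t" for l
  proof (cases "l = 0")
    case True
    then have "is_inv (1 - l *\<^sub>C a) 1" using eqq_refl by (auto simp: is_inv_def mems)
    then show ?thesis by blast
  next
    case False
    obtain t where t: "is_inv (a - (1/l) *\<^sub>C 1) t" using inv by blast
    have e: "1 - l *\<^sub>C a = (- l) *\<^sub>C (a - (1/l) *\<^sub>C 1)"
      using False by (simp add: scaleC_diff_right scaleC_scaleC scaleC_minus_left scaleC_one)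
    have "is_inv (1 - l *\<^sub>C a) ((- 1/l) *\<^sub>C t)"
      using t False a unfolding e
      by (auto simp: is_inv_def mult_scaleC_left mult_scaleC_right scaleC_scaleC scaleC_one mems)
    then show ?thesis by blast
  qed
  then have lim: "(\<lambda>k. T ^ (2 ^ k) * q (a ^ (2 ^ k))) \<longlonglongrightarrow> 0"
    using dyadic_powers_tendsto_zero[OF a T] by blast
  have as: "a ^ n * s ^ n \<simeq> 1" for n
  proof (induction n)
    case 0
    then show ?case by (simp add: eqq_refl mems)
  next
    case (Suc n)
    have "a * (a ^ n * s ^ n) * s \<simeq> a * 1 * s"
      using Suc a sD by (intro eqq_mult_left eqq_mult_right) auto
    then have "a ^ Suc n * s ^ Suc n \<simeq> a * s" by (simp add: mult.assoc power_Suc2 del: power_Suc)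
        (metis mult.assoc power_Suc power_commutes)
    then show ?case using eqq_trans sD(2) by blast
  qed
  have "q 1 \<le> T ^ n * q (a ^ n)" for n
  proof -
    have "q 1 = q (a ^ n * s ^ n)" using eqq_q[OF as] by simp
    also have "\<dots> \<le> q (a ^ n) * T ^ n"
    proof (rule q_mult_le)
      have "q (s ^ n) \<le> q s ^ n" using q_power sD by blast
      also have "\<dots> \<le> T ^ n" using q_nonneg by (intro power_mono) (auto simp: T_def)
      finally show "q (s ^ n) \<le> T ^ n" .
    qed (use a sD in \<open>auto simp: mems\<close>)
    finally show ?thesis by (simp add: mult.commute)
  qed
  then have "q 1 \<le> 0" using lim by (intro tendsto_lowerbound[OF lim]) auto
  then show ?thesis using q_nonneg[of 1] by simp
qed

end

section \<open>Spectra and polynomial calculus\<close>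

lemma invertible_elI: "a * b = 1 \<Longrightarrow> b * a = 1 \<Longrightarrow> invertible_el a"
  by (auto simp: invertible_el_def)

lemma invertible_el_mult:
  assumes "invertible_el a" "invertible_el b" shows "invertible_el (a * b)"
proof -
  obtain a' b' where i: "a * a' = 1" "a' * a = 1" "b * b' = 1" "b' * b = 1"
    using assms by (auto simp: invertible_el_def)
  have "a * b * (b' * a') = a * (b * b') * a'" "b' * a' * (a * b) = b' * (a' * a) * b"
    by (simp_all only: mult.assoc)
  then show ?thesis using i by (intro invertible_elI[of _ "b' * a'"]) auto
qed

lemma invertible_el_scaleC:
  fixes a :: "'a::complex_banach_algebra_1"
  assumes "invertible_el a" "c \<noteq> 0" shows "invertible_el (c *\<^sub>C a)"
proof -
  obtain b where "a * b = 1" "b * a = 1" using assms by (auto simp: invertible_el_def)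
  then show ?thesis using assms(2)
    by (intro invertible_elI[of _ "(1/c) *\<^sub>C b"])
      (auto simp: mult_scaleC_left mult_scaleC_right scaleC_scaleC scaleC_one)
qed

lemma invertible_el_one_minus:
  fixes x :: "'a::complex_banach_algebra_1"
  assumes "norm x < 1" shows "invertible_el (1 - x)"
proof -
  have s: "summable (\<lambda>n. x ^ n)"
    by (rule summable_comparison_test'[of "\<lambda>n. norm x ^ n"])
      (use assms in \<open>auto intro: norm_power_ineq\<close>)
  let ?s = "\<Sum>n. x ^ n"
  have split: "?s = (\<Sum>n. x ^ Suc n) + 1" using suminf_split_head[OF s] by simp
  have "x * ?s = (\<Sum>n. x * x ^ n)" by (rule suminf_mult[symmetric, OF s])
  moreover have "?s * x = (\<Sum>n. x ^ n * x)" by (rule suminf_mult2[OF s])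
  ultimately have "x * ?s = ?s - 1" "?s * x = ?s - 1"
    using split by (simp_all add: power_commutes)
  then show ?thesis by (intro invertible_elI[of _ ?s]) (auto simp: algebra_simps)
qed

lemma invertible_el_near_one:
  fixes x :: "'a::complex_banach_algebra_1"
  assumes "norm (x - 1) < 1" shows "invertible_el x"
  using invertible_el_one_minus[of "1 - x"] assms by (simp add: norm_minus_commute)

text \<open>For \<open>l\<close> farther from \<open>c\<close> than \<open>norm (a - c)\<close>, the
  element \<open>a - l\<close> is a nonzero multiple of \<open>1 - x\<close> with
  \<open>norm x < 1\<close>. The free centre pays off later: imaginary centres show that selfadjoint
  spectra are real, and \<open>c = 1\<close> locates spectra of elements near the unit.\<close>

lemma spec_dist_le:
  assumes "l \<in> spec a" shows "cmod (l - c) \<le> norm (a - c *\<^sub>C 1)"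
proof (rule ccontr)
  define b where "b = a - c *\<^sub>C 1"
  define m where "m = l - c"
  assume "\<not> ?thesis"
  then have m: "cmod m > norm b" by (simp add: m_def b_def)
  then have "m \<noteq> 0" by auto
  have "norm ((1/m) *\<^sub>C b) < 1" using m \<open>m \<noteq> 0\<close> by (simp add: norm_scaleC norm_divide)
  then have "invertible_el ((- m) *\<^sub>C (1 - (1/m) *\<^sub>C b))"
    using \<open>m \<noteq> 0\<close> by (intro invertible_el_scaleC invertible_el_one_minus) auto
  moreover have "(- m) *\<^sub>C (1 - (1/m) *\<^sub>C b) = b - m *\<^sub>C 1"
    using \<open>m \<noteq> 0\<close> by (simp add: scaleC_diff_right scaleC_scaleC scaleC_minus_left scaleC_one)
  moreover have "b - m *\<^sub>C 1 = a - l *\<^sub>C 1" by (simp add: b_def m_def scaleC_diff_left)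
  ultimately show False using assms by (simp add: spec_def)
qed

lemma spec_norm_le: "l \<in> spec a \<Longrightarrow> cmod l \<le> norm a"
  using spec_dist_le[of l a 0] by simp

lemma bdd_above_Re_spec: "bdd_above (Re ` spec a)"
  by (rule bdd_aboveI2[of _ _ "norm a"])
    (use order_trans[OF complex_Re_le_cmod spec_norm_le] in auto)

lemma zero_in_spec_iff: "0 \<in> spec a \<longleftrightarrow> \<not> invertible_el a"
  by (simp add: spec_def)

text \<open>With \<open>b\<close> the inverse of \<open>a\<close>, \<open>a - l\<close> factors as
  \<open>a * (1 - l b)\<close>, which is invertible once \<open>norm (l b) < 1\<close>.\<close>

lemma spec_bounded_away:
  assumes "invertible_el a" shows "\<exists>c>0. \<forall>l\<in>spec a. c \<le> cmod l"
proof -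
  obtain b where b: "a * b = 1" "b * a = 1" using assms by (auto simp: invertible_el_def)
  have nb: "norm b > 0" using b by auto
  have "1 / norm b \<le> cmod l" if l: "l \<in> spec a" for l
  proof (rule ccontr)
    assume "\<not> ?thesis"
    then have "norm (l *\<^sub>C b) < 1" using nb by (simp add: norm_scaleC field_simps)
    then have "invertible_el (a * (1 - l *\<^sub>C b))"
      using assms by (intro invertible_el_mult invertible_el_one_minus) auto
    moreover have "a * (1 - l *\<^sub>C b) = a - l *\<^sub>C 1"
      by (simp add: right_diff_distrib mult_scaleC_right b)
    ultimately show False using l by (simp add: spec_def)
  qed
  then show ?thesis using nb by (intro exI[of _ "1 / norm b"]) auto
qed

section \<open>Polynomial evaluation and spectral mapping\<close>

definition poly_ev :: "complex poly \<Rightarrow> 'a::complex_banach_algebra_1 \<Rightarrow> 'a" where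
  "poly_ev p a = fold_coeffs (\<lambda>c r. c *\<^sub>C 1 + a * r) p 0"

lemma poly_ev_0 [simp]: "poly_ev 0 a = 0"
  by (simp add: poly_ev_def)

lemma poly_ev_pCons [simp]: "poly_ev (pCons c p) a = c *\<^sub>C 1 + a * poly_ev p a"
  by (cases "p = 0 \<and> c = 0") (auto simp: poly_ev_def)

lemma poly_ev_add: "poly_ev (p + q) a = poly_ev p a + poly_ev q a"
  by (induction p q rule: poly_induct2) (auto simp: scaleC_add_left algebra_simps)

lemma poly_ev_smult: "poly_ev (smult c p) a = c *\<^sub>C poly_ev p a"
  by (induction p) (auto simp: scaleC_add_right scaleC_scaleC mult_scaleC_right)

text \<open>Induction on the degree: a root \<open>z\<close> outside the spectrum contributes an
  invertible factor \<open>a - z\<close>, so the failure to be invertible passes to the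
  cofactor.\<close>

lemma poly_ev_noninvertible:
  assumes "\<not> invertible_el (poly_ev p a)" "p \<noteq> 0"
  shows "\<exists>l\<in>spec a. poly p l = 0"
  using assms
proof (induction "degree p" arbitrary: p)
  case 0
  then obtain c where c: "p = [:c:]" by (metis degree_eq_zeroE)
  then have "invertible_el (c *\<^sub>C (1::'a))"
    using 0 by (intro invertible_el_scaleC) (auto intro: invertible_elI[of _ 1])
  then show ?case using 0 c by simp
next
  case (Suc n)
  have "\<not> constant (poly p)" using Suc.hyps(2) by (simp add: constant_degree)
  then obtain z where z: "poly p z = 0" using fundamental_theorem_of_algebra by blast
  then obtain r where r: "p = [:- z, 1:] * r" by (auto simp: poly_eq_0_iff_dvd)
  show ?case
  proof (cases "z \<in> spec a")
    case True
    then show ?thesis using z by blast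
  next
    case False
    have "poly_ev p a = (a - z *\<^sub>C 1) * poly_ev r a"
      unfolding r mult_pCons_left poly_ev_add poly_ev_smult
      by (simp add: scaleC_minus_left mult_scaleC_left algebra_simps)
    then have "\<not> invertible_el (poly_ev r a)"
      using Suc.prems(1) False invertible_el_mult by (auto simp: spec_def)
    moreover have r0: "r \<noteq> 0" using Suc.prems r by auto
    moreover have "n = degree r"
      using Suc.hyps(2) degree_mult_eq[of "[:- z, 1:]" r] r0 by (simp add: r)
    ultimately obtain l where "l \<in> spec a" "poly r l = 0" using Suc.hyps(1) by blast
    then show ?thesis by (auto simp: r)
  qed
qed

text \<open>The previous lemma for \<open>p - m\<close>. Nonemptiness of the spectrum covers the
  constant polynomial \<open>m\<close>, for which \<open>p - m\<close> is zero and every point is a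
  root.\<close>

lemma spec_poly_ev:
  assumes "m \<in> spec (poly_ev p a)" "spec a \<noteq> {}"
  shows "\<exists>l\<in>spec a. poly p l = m"
proof (cases "p = [:m:]")
  case True
  then show ?thesis using assms(2) by auto
next
  case False
  have "poly_ev (p + [:- m:]) a = poly_ev p a - m *\<^sub>C 1"
    by (simp only: poly_ev_add) (simp add: scaleC_minus_left)
  then have "\<not> invertible_el (poly_ev (p + [:- m:]) a)" using assms by (simp add: spec_def)
  moreover have "p + [:- m:] \<noteq> 0" using False by (metis add.inverse_inverse add_eq_0_iff minus_pCons minus_zero)
  ultimately obtain l where "l \<in> spec a" "poly (p + [:- m:]) l = 0"
    using poly_ev_noninvertible by blast
  then show ?thesis by auto
qed

definition rpoly_ev :: "real poly \<Rightarrow> 'a::complex_banach_algebra_1 \<Rightarrow> 'a" where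
  "rpoly_ev p a = fold_coeffs (\<lambda>c r. c *\<^sub>R 1 + a * r) p 0"

lemma rpoly_ev_0 [simp]: "rpoly_ev 0 a = 0"
  by (simp add: rpoly_ev_def)

lemma rpoly_ev_pCons [simp]: "rpoly_ev (pCons c p) a = c *\<^sub>R 1 + a * rpoly_ev p a"
  by (cases "p = 0 \<and> c = 0") (auto simp: rpoly_ev_def)

lemma rpoly_ev_1 [simp]: "rpoly_ev 1 a = 1"
  by (simp add: one_pCons)

lemma rpoly_ev_add: "rpoly_ev (p + q) a = rpoly_ev p a + rpoly_ev q a"
  by (induction p q rule: poly_induct2) (auto simp: algebra_simps)

lemma rpoly_ev_diff: "rpoly_ev (p - q) a = rpoly_ev p a - rpoly_ev q a"
  using rpoly_ev_add[of "p - q" q a] by simp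

lemma rpoly_ev_commute: "a * rpoly_ev p a = rpoly_ev p a * a"
proof (induction p)
  case (pCons c p)
  then show ?case by (simp add: distrib_left distrib_right) (metis mult.assoc)
qed simp

lemma rpoly_ev_eq_poly_ev: "rpoly_ev p a = poly_ev (map_poly of_real p) a"
  by (induction p) (auto simp: map_poly_pCons scaleR_scaleC)

lemma poly_map_poly_of_real: "poly (map_poly of_real p) (of_real t :: complex) = of_real (poly p t)"
  by (induction p) (auto simp: map_poly_pCons)

lemma real_poly_approximation:
  fixes f :: "real \<Rightarrow> real"
  assumes "continuous_on UNIV f" "e > 0"
  shows "\<exists>p. \<forall>t. \<bar>t\<bar> \<le> R \<longrightarrow> \<bar>poly p t - f t\<bar> < e"
proof -
  obtain g where g: "real_polynomial_function g" "\<And>t. t \<in> {- R..R} \<Longrightarrow> \<bar>f t - g t\<bar> < e"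
    using Stone_Weierstrass_real_polynomial_function[of "{- R..R}" f e] assms
      continuous_on_subset[OF assms(1), of "{- R..R}"] by auto
  obtain c n where cn: "g = (\<lambda>x. \<Sum>i\<le>n. c i * x ^ i)"
    using g(1) by (auto simp: real_polynomial_function_iff_sum)
  have "poly (\<Sum>i\<le>n. monom (c i) i) t = g t" for t
    by (simp add: cn poly_sum poly_monom)
  then show ?thesis using g(2)
    by (intro exI[of _ "\<Sum>i\<le>n. monom (c i) i"]) (auto simp: abs_minus_commute abs_le_iff)
qed

lemma real_poly_approximation_vanishing:
  fixes f :: "real \<Rightarrow> real"
  assumes "continuous_on UNIV f" "e > 0" "f 0 = 0" "R \<ge> 0"
  shows "\<exists>p. \<forall>t. \<bar>t\<bar> \<le> R \<longrightarrow> \<bar>poly (pCons 0 p) t - f t\<bar> < e"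
proof -
  obtain p where p: "\<And>t. \<bar>t\<bar> \<le> R \<Longrightarrow> \<bar>poly p t - f t\<bar> < e/2"
    using real_poly_approximation[OF assms(1), of "e/2" R] assms by auto
  obtain c r where cr: "p = pCons c r" by (rule pCons_cases)
  have "\<bar>c\<bar> < e/2" using p[of 0] assms by (simp add: cr)
  then have "\<bar>poly (pCons 0 r) t - f t\<bar> < e" if "\<bar>t\<bar> \<le> R" for t
    using p[OF that] unfolding cr poly_pCons by linarith
  then show ?thesis by blast
qed

section \<open>Selfadjoint elements: spectrum and norm\<close>

locale cstar_algebra =
  fixes st :: "'a::complex_banach_algebra_1 \<Rightarrow> 'a"
  assumes involution: "cstar_involution st"
begin

lemma st_add: "st (a + b) = st a + st b"
  and st_scaleC: "st (c *\<^sub>C a) = cnj c *\<^sub>C st a"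
  and st_mult: "st (a * b) = st b * st a"
  and st_st [simp]: "st (st a) = a"
  and norm_st_mult: "norm (st a * a) = norm a ^ 2"
  using involution by (auto simp: cstar_involution_def)

lemma st_scaleR: "st (r *\<^sub>R a) = r *\<^sub>R st a"
  by (simp add: scaleR_scaleC st_scaleC)

lemma st_zero [simp]: "st 0 = 0"
  using st_add[of 0 0] by simp

lemma st_one [simp]: "st 1 = 1"
  using st_mult[of 1 "st 1"] by simp

lemma st_diff: "st (a - b) = st a - st b"
  using st_add[of "a - b" b] by simp

lemma norm_st [simp]: "norm (st a) = norm a"
proof -
  have le: "norm a \<le> norm (st a)" for a
  proof (cases "a = 0")
    case False
    have "norm a * norm a \<le> norm (st a) * norm a"
      using norm_mult_ineq[of "st a" a] by (simp add: norm_st_mult power2_eq_square)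
    then show ?thesis using False by simp
  qed simp
  from le[of a] le[of "st a"] show ?thesis by simp
qed

lemma tendsto_st: "(f \<longlongrightarrow> l) F \<Longrightarrow> ((\<lambda>x. st (f x)) \<longlongrightarrow> st l) F"
proof -
  have "bounded_linear st"
    by (rule bounded_linear_intro[of _ 1]) (auto simp: st_add st_scaleR)
  then show "(f \<longlongrightarrow> l) F \<Longrightarrow> ((\<lambda>x. st (f x)) \<longlongrightarrow> st l) F"
    by (rule bounded_linear.tendsto)
qed

lemma norm_sq_selfadjoint: "st a = a \<Longrightarrow> norm (a * a) = norm a ^ 2"
  using norm_st_mult[of a] by simp

lemma st_power: "st (a ^ n) = st a ^ n"
  by (induction n) (auto simp: st_mult power_commutes)

lemma norm_dyadic_power:
  assumes "st a = a" shows "norm (a ^ (2 ^ k)) = norm a ^ (2 ^ k)"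
proof (induction k)
  case (Suc k)
  have "norm (a ^ (2 ^ k) * a ^ (2 ^ k)) = norm (a ^ (2 ^ k)) ^ 2"
    by (rule norm_sq_selfadjoint) (simp add: st_power assms)
  then show ?case by (simp add: Suc power_add[symmetric] mult_2 power2_eq_square)
qed simp

text \<open>Arens' trick: \<open>l + i t\<close> has modulus at most \<open>norm (a + i t)\<close>,
  whose square is at most \<open>norm a ^ 2 + t ^ 2\<close>. The terms \<open>t ^ 2\<close> cancel,
  and what remains would bound a linear function of \<open>t\<close> on the whole line.\<close>

lemma spec_selfadjoint_real:
  assumes a: "st a = a" and l: "l \<in> spec a"
  shows "Im l = 0"
proof (rule ccontr)
  assume nz: "Im l \<noteq> 0"
  have bound: "2 * Im l * t \<le> norm a ^ 2" for t :: real
  proof -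
    let ?c = "- (\<i> * of_real t)"
    have "(cmod (l - ?c))\<^sup>2 \<le> (norm (a - ?c *\<^sub>C 1))\<^sup>2"
      by (intro power_mono spec_dist_le[OF l] norm_ge_zero)
    also have "(norm (a - ?c *\<^sub>C 1))\<^sup>2 = norm (st (a - ?c *\<^sub>C 1) * (a - ?c *\<^sub>C 1))"
      by (simp add: norm_st_mult)
    also have "st (a - ?c *\<^sub>C 1) = a + ?c *\<^sub>C 1"
      by (simp add: st_diff st_add st_scaleC a scaleC_minus_left)
    also have "(a + ?c *\<^sub>C 1) * (a - ?c *\<^sub>C 1) = a * a - (?c * ?c) *\<^sub>C 1"
      by (simp add: algebra_simps mult_scaleC_left mult_scaleC_right scaleC_scaleC scaleC_add_right)
    also have "?c * ?c = of_real (- (t ^ 2))" by (simp add: power2_eq_square algebra_simps)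
    also have "norm (a * a - of_real (- (t ^ 2)) *\<^sub>C 1) \<le> norm (a * a) + norm (complex_of_real (- (t ^ 2)) *\<^sub>C (1::'a))"
      by (rule norm_triangle_ineq4)
    also have "\<dots> = norm a ^ 2 + t ^ 2"
      by (simp add: norm_scaleC norm_sq_selfadjoint[OF a] norm_power)
    finally have "(Re l)\<^sup>2 + (Im l + t)\<^sup>2 \<le> norm a ^ 2 + t ^ 2"
      by (simp add: cmod_power2)
    then have "(Re l)\<^sup>2 + (Im l)\<^sup>2 + 2 * Im l * t \<le> norm a ^ 2"
      by (simp add: power2_sum algebra_simps)
    then show ?thesis using zero_le_power2[of "Re l"] zero_le_power2[of "Im l"] by linarith
  qed
  from bound[of "(norm a ^ 2 + 1) / (2 * Im l)"] nz show False by simp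
qed

text \<open>Were the circle of radius \<open>norm a\<close> free of spectrum, \<open>1 - l a\<close>
  would be invertible on the closed disc of radius \<open>1 / norm a\<close>, and the dyadic powers
  of \<open>a\<close>, scaled by powers of that radius, would tend to \<open>0\<close>; the
  C*-identity keeps their norms equal to \<open>1\<close>. In particular the spectrum is
  nonempty.\<close>

lemma norm_in_spec:
  assumes a: "st a = a" shows "\<exists>l\<in>spec a. cmod l = norm a"
proof (cases "a = 0")
  case True
  then show ?thesis by (auto simp: zero_in_spec_iff invertible_el_def intro!: bexI[of _ 0])
next
  case False
  show ?thesis
  proof (rule ccontr)
    assume no: "\<not> ?thesis"
    interpret seminormed_subalgebra UNIV "norm :: 'a \<Rightarrow> real"
      by unfold_locales (auto simp: norm_triangle_ineq norm_mult_ineq norm_scaleC)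
    have "\<exists>s. is_inv (1 - l *\<^sub>C a) s" if l: "cmod l \<le> 1 / norm a" for l
    proof -
      have "invertible_el (1 - l *\<^sub>C a)"
      proof (cases "l = 0")
        case True
        then show ?thesis by (auto intro: invertible_elI[of _ 1])
      next
        case l0: False
        have "cmod (1/l) \<ge> norm a" using l l0 False by (simp add: norm_divide field_simps)
        then have "1/l \<notin> spec a" using no spec_norm_le[of "1/l" a] by force
        then have "invertible_el ((- l) *\<^sub>C (a - (1/l) *\<^sub>C 1))"
          using l0 by (intro invertible_el_scaleC) (auto simp: spec_def)
        then show ?thesis
          using l0 by (simp add: scaleC_diff_right scaleC_scaleC scaleC_minus_left scaleC_one)
      qed
      then show ?thesis by (auto simp: invertible_el_def is_inv_def eqq_def)
    qed
    then have "(\<lambda>k. (1 / norm a) ^ (2 ^ k) * norm (a ^ (2 ^ k))) \<longlonglongrightarrow> 0"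
      using False by (intro dyadic_powers_tendsto_zero) auto
    moreover have "(1 / norm a) ^ (2 ^ k) * norm (a ^ (2 ^ k)) = 1" for k
      using False by (simp add: norm_dyadic_power[OF a] power_one_over)
    ultimately show False by (simp add: LIMSEQ_const_iff)
  qed
qed

lemma st_rpoly_ev: "st a = a \<Longrightarrow> st (rpoly_ev p a) = rpoly_ev p a"
  by (induction p) (auto simp: st_add st_mult st_scaleR rpoly_ev_commute)

text \<open>The norm of the selfadjoint element \<open>p(a)\<close> is attained on its spectrum,
  which consists of values of \<open>p\<close> at real points of \<open>spec a\<close>. This
  estimate does the work of a continuous functional calculus.\<close>

lemma norm_rpoly_ev_le:
  assumes a: "st a = a"
    and M: "\<And>t. of_real t \<in> spec a \<Longrightarrow> \<bar>poly p t\<bar> \<le> M"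
  shows "norm (rpoly_ev p a) \<le> M"
proof -
  obtain m where m: "m \<in> spec (rpoly_ev p a)" "cmod m = norm (rpoly_ev p a)"
    using norm_in_spec st_rpoly_ev[OF a] by blast
  have "spec a \<noteq> {}" using norm_in_spec[OF a] by auto
  then obtain l where l: "l \<in> spec a" "poly (map_poly of_real p) l = m"
    using spec_poly_ev m(1) unfolding rpoly_ev_eq_poly_ev by blast
  have "l = of_real (Re l)" using spec_selfadjoint_real[OF a l(1)] by (simp add: complex_eq_iff)
  then have "\<bar>poly p (Re l)\<bar> \<le> M" "m = of_real (poly p (Re l))"
    using M[of "Re l"] l poly_map_poly_of_real[of p "Re l"] by auto
  then show ?thesis using m(2) by simp
qed

lemma norm_rpoly_ev_le_interval:
  assumes a: "st a = a" and r: "norm (a - c *\<^sub>R 1) \<le> r"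
    and M: "\<And>t. \<bar>t - c\<bar> \<le> r \<Longrightarrow> \<bar>poly p t\<bar> \<le> M"
  shows "norm (rpoly_ev p a) \<le> M"
proof (rule norm_rpoly_ev_le[OF a])
  fix t assume "of_real t \<in> spec a"
  then have "cmod (of_real t - of_real c) \<le> norm (a - c *\<^sub>R 1)"
    using spec_dist_le[of "of_real t" a "of_real c"] by (simp add: scaleR_scaleC)
  then show "\<bar>poly p t\<bar> \<le> M" using M[of t] r by (simp flip: of_real_diff)
qed

text \<open>On the spectrum \<open>\<bar>t\<bar>\<close> lies between some \<open>c > 0\<close> and
  \<open>norm a\<close>, so \<open>1 - t^2 / norm a ^ 2\<close> stays between \<open>0\<close> and a
  number below \<open>1\<close>. Invertibility becomes a norm inequality.\<close>

lemma norm_one_minus_square_lt: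
  assumes a: "st a = a" and inv: "invertible_el a"
  shows "norm (1 - (1 / norm a ^ 2) *\<^sub>R (a * a)) < 1"
proof -
  have n: "norm a > 0" using inv by (auto simp: invertible_el_def)
  obtain c where c: "c > 0" "\<And>l. l \<in> spec a \<Longrightarrow> c \<le> cmod l"
    using spec_bounded_away[OF inv] by blast
  have e: "rpoly_ev [:1, 0, - (1 / norm a ^ 2):] a = 1 - (1 / norm a ^ 2) *\<^sub>R (a * a)"
    by simp
  have "norm (rpoly_ev [:1, 0, - (1 / norm a ^ 2):] a) \<le> 1 - c ^ 2 / norm a ^ 2"
  proof (rule norm_rpoly_ev_le[OF a])
    fix t assume t: "complex_of_real t \<in> spec a"
    have "c\<^sup>2 \<le> \<bar>t\<bar>\<^sup>2"
      by (rule power_mono) (use c(2)[OF t] c(1) in auto)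
    moreover have "\<bar>t\<bar>\<^sup>2 \<le> norm a ^ 2"
      by (rule power_mono) (use spec_norm_le[OF t] in auto)
    moreover have "poly [:1, 0, - (1 / norm a ^ 2):] t = 1 - t\<^sup>2 / norm a ^ 2"
      by (simp add: power2_eq_square)
    ultimately show "\<bar>poly [:1, 0, - (1 / norm a ^ 2):] t\<bar> \<le> 1 - c ^ 2 / norm a ^ 2"
      using n by (simp add: field_simps)
  qed
  moreover have "c ^ 2 / norm a ^ 2 > 0" using c n by simp
  ultimately show ?thesis unfolding e by linarith
qed

end

section \<open>Pairs with disjoint spectra\<close>

context cstar_algebra
begin

definition pair_algebra :: "('a \<times> 'a) set \<Rightarrow> bool" where
  "pair_algebra D \<longleftrightarrow> closed D \<and> (1, 1) \<in> D \<and>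
     (\<forall>a b c d. (a, b) \<in> D \<longrightarrow> (c, d) \<in> D \<longrightarrow> (a + c, b + d) \<in> D \<and> (a * c, b * d) \<in> D) \<and>
     (\<forall>a b c. (a, b) \<in> D \<longrightarrow> (c *\<^sub>C a, c *\<^sub>C b) \<in> D) \<and>
     (\<forall>a b. (a, b) \<in> D \<longrightarrow> (st a, st b) \<in> D)"

lemma
  assumes "pair_algebra D"
  shows pair_closed: "closed D"
    and pair_one: "(1, 1) \<in> D"
    and pair_add: "(a, b) \<in> D \<Longrightarrow> (c, d) \<in> D \<Longrightarrow> (a + c, b + d) \<in> D"
    and pair_mult: "(a, b) \<in> D \<Longrightarrow> (c, d) \<in> D \<Longrightarrow> (a * c, b * d) \<in> D"
    and pair_scaleC: "(a, b) \<in> D \<Longrightarrow> (l *\<^sub>C a, l *\<^sub>C b) \<in> D"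
    and pair_st: "(a, b) \<in> D \<Longrightarrow> (st a, st b) \<in> D"
  using assms unfolding pair_algebra_def by blast+

lemma pair_diff:
  assumes "pair_algebra D" "(a, b) \<in> D" "(c, d) \<in> D" shows "(a - c, b - d) \<in> D"
  using pair_add[OF assms(1,2) pair_scaleC[OF assms(1,3), of "-1"]] by (simp add: scaleC_minus_one)

lemma invertible_el_st: "invertible_el a \<Longrightarrow> invertible_el (st a)"
  unfolding invertible_el_def by (metis st_mult st_one)

lemma pair_swap:
  assumes "pair_algebra D" shows "pair_algebra (prod.swap ` D)"
proof -
  have "prod.swap ` D = prod.swap -` D" by force
  moreover have "closed (prod.swap -` D)"
    by (intro closed_vimage pair_closed[OF assms] continuous_intros)
  ultimately show ?thesis using assms unfolding pair_algebra_def by auto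
qed

lemma pair_rpoly_ev:
  assumes "pair_algebra D" "(a, b) \<in> D" shows "(rpoly_ev p a, rpoly_ev p b) \<in> D"
proof (induction p)
  case 0
  show ?case using pair_scaleC[OF assms(1) pair_one[OF assms(1)], of 0] by simp
next
  case (pCons c p)
  show ?case
    using pair_add[OF assms(1) pair_scaleC[OF assms(1) pair_one[OF assms(1)], of "of_real c"]
        pair_mult[OF assms pCons.IH]]
    by (simp add: scaleR_scaleC)
qed

text \<open>Uniform closeness of polynomials on \<open>[-R, R]\<close> becomes closeness in norm, so
  the values form a Cauchy sequence. The limit is left anonymous: the same \<open>P\<close> will be
  applied to both coordinates of a pair, and only in one of them is the limit identified.\<close>

lemma rpoly_ev_uniform_limit:
  assumes k: "st k = k" "norm k \<le> R"
    and P: "\<And>n t. \<bar>t\<bar> \<le> R \<Longrightarrow> \<bar>poly (P n) t - f t\<bar> < 1 / real (Suc n)"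
  shows "convergent (\<lambda>n. rpoly_ev (P n) k)"
proof -
  have "Cauchy (\<lambda>n. rpoly_ev (P n) k)"
  proof (rule CauchyI)
    fix e :: real assume "e > 0"
    then obtain N where N: "1 / real (Suc N) < e / 2" using nat_approx_posE[of "e/2"] by auto
    have "norm (rpoly_ev (P m) k - rpoly_ev (P n) k) < e" if mn: "m \<ge> N" "n \<ge> N" for m n
    proof -
      have "norm (rpoly_ev (P m - P n) k) \<le> 2 * (1 / real (Suc N))"
      proof (rule norm_rpoly_ev_le_interval[OF k(1), of 0])
        fix t :: real assume "\<bar>t - 0\<bar> \<le> R"
        then have "\<bar>poly (P m) t - f t\<bar> < 1 / real (Suc m)" "\<bar>poly (P n) t - f t\<bar> < 1 / real (Suc n)"
          using P by auto
        moreover have "1 / real (Suc m) \<le> 1 / real (Suc N)" "1 / real (Suc n) \<le> 1 / real (Suc N)"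
          using mn by (auto intro!: divide_left_mono)
        ultimately show "\<bar>poly (P m - P n) t\<bar> \<le> 2 * (1 / real (Suc N))"
          unfolding poly_diff by linarith
      qed (use k in simp)
      then show ?thesis using N by (simp add: rpoly_ev_diff)
    qed
    then show "\<exists>M. \<forall>m\<ge>M. \<forall>n\<ge>M. norm (rpoly_ev (P m) k - rpoly_ev (P n) k) < e" by blast
  qed
  then show ?thesis by (simp add: Cauchy_convergent_iff)
qed

text \<open>The inverse of \<open>b\<close> is a limit of polynomials in \<open>b\<close> and its adjoint; approximating a bounded extension
  of \<open>1/t\<close> keeps these polynomials convergent in the other coordinate.\<close>

lemma pair_inverse:
  assumes D: "pair_algebra D" and ab: "(a, b) \<in> D" and inv: "invertible_el b"
  shows "\<exists>s t. (s, t) \<in> D \<and> t * b = 1 \<and> b * t = 1"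
proof -
  \<comment> \<open>Real polynomials call for selfadjoint arguments; in the end the inverse of
    \<open>k2\<close> times \<open>st b\<close> is the inverse of \<open>b\<close>.\<close>
  define k1 k2 where k: "k1 = st a * a" "k2 = st b * b"
  have kD: "(k1, k2) \<in> D" using pair_mult[OF D pair_st[OF D ab] ab] by (simp add: k)
  have sa: "st k1 = k1" "st k2 = k2" by (simp_all add: k st_mult)
  obtain b' where b': "b * b' = 1" "b' * b = 1" using inv by (auto simp: invertible_el_def)
  have "invertible_el k2" using inv by (simp add: k invertible_el_mult invertible_el_st)
  then obtain c where c: "c > 0" "\<And>l. l \<in> spec k2 \<Longrightarrow> c \<le> cmod l"
    using spec_bounded_away by blast
  define R where "R = max (norm k1) (norm k2)"
  have R: "norm k1 \<le> R" "norm k2 \<le> R" "R \<ge> 0" by (auto simp: R_def le_max_iff_disj)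
  \<comment> \<open>Equals \<open>1/t\<close> for \<open>\<bar>t\<bar> \<ge> c\<close>, hence on the
    spectrum of \<open>k2\<close>, and stays continuous at \<open>0\<close>, which the spectrum of
    \<open>k1\<close> may contain.\<close>
  define f where "f t = t / max (c\<^sup>2) (t\<^sup>2)" for t :: real
  have "continuous_on UNIV f" unfolding f_def using c(1)
    by (intro continuous_intros) (auto simp: max_def)
  then have "\<exists>p. \<forall>t. \<bar>t\<bar> \<le> R \<longrightarrow> \<bar>poly p t - f t\<bar> < 1 / real (Suc n)" for n
    by (intro real_poly_approximation) auto
  then obtain P where P: "\<And>n t. \<bar>t\<bar> \<le> R \<Longrightarrow> \<bar>poly (P n) t - f t\<bar> < 1 / real (Suc n)"
    by metis
  obtain s t where st: "(\<lambda>n. rpoly_ev (P n) k1) \<longlonglongrightarrow> s" "(\<lambda>n. rpoly_ev (P n) k2) \<longlonglongrightarrow> t"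
    using rpoly_ev_uniform_limit[OF sa(1) R(1) P] rpoly_ev_uniform_limit[OF sa(2) R(2) P]
    by (auto simp: convergent_def)
  have stD: "(s, t) \<in> D"
    using closed_sequentially[OF pair_closed[OF D], of "\<lambda>n. (rpoly_ev (P n) k1, rpoly_ev (P n) k2)"]
      pair_rpoly_ev[OF D kD] tendsto_Pair[OF st] by blast
  have bound: "norm (k2 * rpoly_ev (P n) k2 - 1) \<le> R * (1 / real (Suc n))" for n
  proof -
    have "norm (rpoly_ev (pCons 0 (P n) - 1) k2) \<le> R * (1 / real (Suc n))"
    proof (rule norm_rpoly_ev_le[OF sa(2)])
      fix t assume t: "complex_of_real t \<in> spec k2"
      have tR: "c \<le> \<bar>t\<bar>" "\<bar>t\<bar> \<le> R" using c(2)[OF t] spec_norm_le[OF t] R by auto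
      then have "c\<^sup>2 \<le> t\<^sup>2" using c(1) by (metis abs_le_square_iff abs_of_pos)
      moreover have "t \<noteq> 0" using tR c by auto
      ultimately have "t * f t = 1" by (simp add: f_def max_def power2_eq_square)
      then have "poly (pCons 0 (P n) - 1) t = t * (poly (P n) t - f t)" by (simp add: algebra_simps)
      then have "\<bar>poly (pCons 0 (P n) - 1) t\<bar> = \<bar>t\<bar> * \<bar>poly (P n) t - f t\<bar>" by (simp add: abs_mult)
      also have "\<dots> \<le> R * (1 / real (Suc n))"
        using tR P[OF tR(2), of n] R(3) by (intro mult_mono) auto
      finally show "\<bar>poly (pCons 0 (P n) - 1) t\<bar> \<le> R * (1 / real (Suc n))" .
    qed
    then show ?thesis by (simp add: rpoly_ev_diff)
  qed
  have "(\<lambda>n. R * (1 / real (Suc n))) \<longlonglongrightarrow> R * 0"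
    by (intro tendsto_mult tendsto_const LIMSEQ_Suc[OF lim_1_over_n])
  then have "(\<lambda>n. R * (1 / real (Suc n))) \<longlonglongrightarrow> 0" by simp
  then have "(\<lambda>n. k2 * rpoly_ev (P n) k2 - 1) \<longlonglongrightarrow> 0"
    by (rule Lim_null_comparison[rotated]) (use bound in auto)
  moreover have "(\<lambda>n. k2 * rpoly_ev (P n) k2 - 1) \<longlonglongrightarrow> k2 * t - 1"
    by (intro tendsto_intros st)
  moreover have "(\<lambda>n. rpoly_ev (P n) k2 * k2 - 1) \<longlonglongrightarrow> t * k2 - 1"
    by (intro tendsto_intros st)
  ultimately have "k2 * t - 1 = 0" "t * k2 - 1 = 0"
    by (auto simp: rpoly_ev_commute dest: LIMSEQ_unique)
  then have tk: "(t * st b) * b = 1" by (simp add: k mult.assoc)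
  then have "t * st b = b'" using b' by (metis mult.assoc mult_1_left mult_1_right)
  then have "(s * st a, b') \<in> D" using pair_mult[OF D stD pair_st[OF D ab]] by simp
  then show ?thesis using b' by blast
qed

text \<open>Modulo the ideal \<open>J\<close> of all \<open>c\<close> with \<open>(c, 0) \<in> D\<close>, every \<open>a - l\<close> is invertible, so
  Gelfand--Mazur forces \<open>J\<close> to contain \<open>1\<close>.\<close>

lemma pair_disjoint_spectra:
  assumes D: "pair_algebra D" and ab: "(a, b) \<in> D" and disj: "spec a \<inter> spec b = {}"
  shows "(1, 0) \<in> D"
proof -
  define J where "J = {c. (c, 0) \<in> D}"
  define D1 where "D1 = fst ` D"
  have D1I: "c \<in> D1" if "(c, d) \<in> D" for c d using that by (force simp: D1_def)
  have D1E: "\<exists>d. (c, d) \<in> D" if "c \<in> D1" for c using that by (force simp: D1_def)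
  have "J = (\<lambda>c. (c, 0)) -` D" by (auto simp: J_def)
  then have Jcl: "closed J"
    by (simp add: closed_vimage[OF pair_closed[OF D]] continuous_intros)
  have J0: "0 \<in> J" using pair_scaleC[OF D ab, of 0] by (simp add: J_def)
  have JD: "J \<subseteq> D1" using D1I by (auto simp: J_def)
  have Jadd: "x + y \<in> J" if "x \<in> J" "y \<in> J" for x y
    using pair_add[OF D, of x 0 y 0] that by (simp add: J_def)
  have Jsc: "c *\<^sub>C x \<in> J" if "x \<in> J" for x c
    using pair_scaleC[OF D, of x 0 c] that by (simp add: J_def)
  have Jl: "d * x \<in> J" "x * d \<in> J" if xd: "x \<in> J" "d \<in> D1" for x d
  proof -
    obtain e where "(d, e) \<in> D" using D1E xd by blast
    then show "d * x \<in> J" "x * d \<in> J"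
      using pair_mult[OF D, of d e x 0] pair_mult[OF D, of x 0 d e] xd by (auto simp: J_def)
  qed
  have near: "\<exists>j\<in>J. norm (x + j) < infdist x J + e" if "e > 0" for x e
  proof -
    have "infdist x J < infdist x J + e" using that by simp
    moreover have "infdist x J = (INF j\<in>J. dist x j)" using J0 by (auto simp: infdist_def)
    ultimately have "\<exists>j\<in>J. dist x j < infdist x J + e"
      using J0 cINF_less_iff[of J "dist x" "infdist x J + e"] bdd_belowI2[of J 0 "dist x"] by auto
    then obtain j where j: "j \<in> J" "dist x j < infdist x J + e" by blast
    then show ?thesis using Jsc[OF j(1), of "-1"]
      by (intro bexI[of _ "-j"]) (auto simp: dist_norm scaleC_minus_one)
  qed
  have le: "infdist x J \<le> norm (x + j)" if "j \<in> J" for x j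
    using infdist_le[OF Jsc[OF that, of "-1"], of x] by (simp add: dist_norm scaleC_minus_one)
  interpret seminormed_subalgebra D1 "\<lambda>x. infdist x J"
  proof
    show "1 \<in> D1" using D1I[OF pair_one[OF D]] .
    show "infdist x J \<ge> 0" for x by (rule infdist_nonneg)
    show "infdist 1 J \<le> 1" using le[OF J0, of 1] by simp
    fix x y c assume x: "x \<in> D1"
    obtain x' where x': "(x, x') \<in> D" using D1E x by blast
    show "c *\<^sub>C x \<in> D1" using D1I[OF pair_scaleC[OF D x']] .
    have scale_le: "infdist (c *\<^sub>C x) J \<le> cmod c * infdist x J" for c x
    proof (rule field_le_epsilon)
      fix e :: real assume e: "e > 0"
      define d where "d = e / (cmod c + 1)"
      have d: "d > 0" using e by (simp add: d_def add_nonneg_pos)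
      obtain j where j: "j \<in> J" "norm (x + j) < infdist x J + d" using near d by blast
      have "infdist (c *\<^sub>C x) J \<le> norm (c *\<^sub>C x + c *\<^sub>C j)" by (intro le Jsc j)
      also have "\<dots> = cmod c * norm (x + j)" by (simp add: scaleC_add_right[symmetric] norm_scaleC)
      also have "\<dots> \<le> cmod c * (infdist x J + d)" using j by (intro mult_left_mono) auto
      also have "\<dots> = cmod c * infdist x J + cmod c * d" by (simp add: distrib_left)
      also have "cmod c * d = e * (cmod c / (cmod c + 1))" by (simp add: d_def)
      also have "\<dots> \<le> e"
        using e by (intro mult_left_le) (auto simp: divide_le_eq_1 add_nonneg_pos)
      finally show "infdist (c *\<^sub>C x) J \<le> cmod c * infdist x J + e" by simp
    qed
    show "infdist (c *\<^sub>C x) J = cmod c * infdist x J"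
    proof (cases "c = 0")
      case True
      then show ?thesis using J0 by simp
    next
      case False
      have "infdist x J \<le> cmod (1/c) * infdist (c *\<^sub>C x) J"
        using scale_le[of "1/c" "c *\<^sub>C x"] False by (simp add: scaleC_scaleC scaleC_one)
      then have "cmod c * infdist x J \<le> infdist (c *\<^sub>C x) J"
        using False by (simp add: norm_divide field_simps)
      then show ?thesis using scale_le[of c x] by simp
    qed
    assume y: "y \<in> D1"
    obtain y' where y': "(y, y') \<in> D" using D1E y by blast
    show "x + y \<in> D1" "x * y \<in> D1" using D1I[OF pair_add[OF D x' y']] D1I[OF pair_mult[OF D x' y']] .
    show "infdist (x + y) J \<le> infdist x J + infdist y J"
    proof (rule field_le_epsilon)
      fix e :: real assume e: "e > 0"
      obtain j where j: "j \<in> J" "norm (x + j) < infdist x J + e/2" using near[of "e/2"] e by auto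
      obtain i where i: "i \<in> J" "norm (y + i) < infdist y J + e/2" using near[of "e/2"] e by auto
      have "infdist (x + y) J \<le> norm (x + y + (j + i))" by (intro le Jadd i j)
      also have "\<dots> \<le> norm (x + j) + norm (y + i)"
        using norm_triangle_ineq[of "x + j" "y + i"] by (simp add: algebra_simps)
      finally show "infdist (x + y) J \<le> infdist x J + infdist y J + e" using i j by simp
    qed
    show "infdist (x * y) J \<le> infdist x J * infdist y J"
    proof -
      have "infdist (x * y) J \<le> (infdist x J + e) * (infdist y J + e)" if e: "e > 0" for e
      proof -
        obtain j where j: "j \<in> J" "norm (x + j) < infdist x J + e" using near e by blast
        obtain i where i: "i \<in> J" "norm (y + i) < infdist y J + e" using near e by blast
        \<comment> \<open>The product \<open>(x + j) * (y + i)\<close> differs from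
          \<open>x * y\<close> by this element of the ideal; letting \<open>e\<close> tend to
          \<open>0\<close> gives submultiplicativity.\<close>
        have "x * i + j * y + j * i \<in> J"
          using Jl i j x y JD by (intro Jadd) auto
        then have "infdist (x * y) J \<le> norm (x * y + (x * i + j * y + j * i))" by (rule le)
        also have "x * y + (x * i + j * y + j * i) = (x + j) * (y + i)" by (simp add: algebra_simps)
        also have "norm \<dots> \<le> norm (x + j) * norm (y + i)" by (rule norm_mult_ineq)
        also have "\<dots> \<le> (infdist x J + e) * (infdist y J + e)"
          using i j e by (intro mult_mono) (auto intro: add_nonneg_nonneg infdist_nonneg)
        finally show ?thesis .
      qed
      then have ev: "eventually (\<lambda>e. infdist (x * y) J \<le> (infdist x J + e) * (infdist y J + e)) (at_right 0)"
        by (auto simp: eventually_at_filter)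
      have "((\<lambda>e. (infdist x J + e) * (infdist y J + e)) \<longlongrightarrow> (infdist x J + 0) * (infdist y J + 0)) (at_right 0)"
        by (intro tendsto_intros)
      then show ?thesis using tendsto_lowerbound[OF _ ev] by simp
    qed
  qed
  have eqqI: "eqq x y" if "x \<in> D1" "y \<in> D1" "x - y \<in> J" for x y
    using that by (simp add: eqq_def)
  have "\<exists>s. is_inv (a - l *\<^sub>C 1) s" for l
  proof -
    have lD: "(a - l *\<^sub>C 1, b - l *\<^sub>C 1) \<in> D"
      by (intro pair_diff[OF D] ab pair_scaleC[OF D] pair_one[OF D])
    \<comment> \<open>In the first case the inverse is exact, from \<open>pair_inverse\<close> with
      the coordinates exchanged. In the second only the second coordinate is inverted; the defect in
      the first has partner \<open>0\<close> and therefore lies in \<open>J\<close>.\<close>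
    consider "invertible_el (a - l *\<^sub>C 1)" | "invertible_el (b - l *\<^sub>C 1)"
      using disj by (auto simp: spec_def)
    then show ?thesis
    proof cases
      case 1
      have "(b - l *\<^sub>C 1, a - l *\<^sub>C 1) \<in> prod.swap ` D" using lD by force
      from pair_inverse[OF pair_swap[OF D] this 1]
      obtain s t where "(s, t) \<in> D" "s * (a - l *\<^sub>C 1) = 1" "(a - l *\<^sub>C 1) * s = 1"
        by (auto simp: image_iff)
      then have "is_inv (a - l *\<^sub>C 1) s"
        using D1I lD eqq_refl[OF one_mem] by (auto simp: is_inv_def)
      then show ?thesis by blast
    next
      case 2
      obtain s t where st: "(s, t) \<in> D" "t * (b - l *\<^sub>C 1) = 1" "(b - l *\<^sub>C 1) * t = 1"
        using pair_inverse[OF D lD 2] by blast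
      have "((a - l *\<^sub>C 1) * s - 1, (b - l *\<^sub>C 1) * t - 1) \<in> D" "(s * (a - l *\<^sub>C 1) - 1, t * (b - l *\<^sub>C 1) - 1) \<in> D"
        by (intro pair_diff[OF D] pair_mult[OF D] lD st pair_one[OF D])+
      then have "(a - l *\<^sub>C 1) * s - 1 \<in> J" "s * (a - l *\<^sub>C 1) - 1 \<in> J"
        by (simp_all add: st J_def)
      then have "is_inv (a - l *\<^sub>C 1) s"
        using D1I[OF lD] D1I[OF st(1)] one_mem mult_mem unfolding is_inv_def by (auto intro!: eqqI)
      then show ?thesis by blast
    qed
  qed
  then have "infdist 1 J = 0" using gelfand_mazur D1I[OF ab] by blast
  then have "1 \<in> J" using Jcl J0 in_closed_iff_infdist_zero[of J 1] by blast
  then show ?thesis by (simp add: J_def)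
qed

end

section \<open>Approximate separation of sets\<close>

lemma continuous_on_cutoff: "continuous_on UNIV (\<lambda>t::real. max 0 (min 1 ((t - c) / d)))"
  by (cases "d = 0") (auto intro!: continuous_intros)

section \<open>Functions vanishing at infinity\<close>

lemma C0_D:
  assumes "f \<in> C0" shows "continuous_on UNIV f"
    and "e > 0 \<Longrightarrow> \<exists>K. compact K \<and> (\<forall>x. x \<notin> K \<longrightarrow> norm (f x) < e)"
  using assms by (auto simp: C0_def)

lemma C0_compact:
  assumes "f \<in> C0" "e > 0" shows "compact {x. e \<le> norm (f x)}"
proof -
  obtain K where K: "compact K" "\<And>x. x \<notin> K \<Longrightarrow> norm (f x) < e"
    using C0_D(2)[OF assms] by blast
  have "closed {x. e \<le> norm (f x)}"
    by (intro closed_Collect_le continuous_intros C0_D[OF assms(1)])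
  then have "compact ({x. e \<le> norm (f x)} \<inter> K)" using K by (intro closed_Int_compact)
  moreover have "{x. e \<le> norm (f x)} \<inter> K = {x. e \<le> norm (f x)}" using K(2) by force
  ultimately show ?thesis by simp
qed

lemma C0_diff:
  assumes "f \<in> C0" "g \<in> C0" shows "(\<lambda>x. f x - g x) \<in> C0"
  unfolding C0_def
proof (intro CollectI conjI allI impI)
  show "continuous_on UNIV (\<lambda>x. f x - g x)" using assms C0_D by (intro continuous_intros) auto
  fix e :: real assume e: "e > 0"
  obtain K where K: "compact K" "\<And>x. x \<notin> K \<Longrightarrow> norm (f x) < e/2"
    using C0_D(2)[OF assms(1), of "e/2"] e by auto
  obtain L where L: "compact L" "\<And>x. x \<notin> L \<Longrightarrow> norm (g x) < e/2"
    using C0_D(2)[OF assms(2), of "e/2"] e by auto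
  have "norm (f x - g x) < e" if "x \<notin> K \<union> L" for x
    using K(2)[of x] L(2)[of x] that norm_triangle_ineq4[of "f x" "g x"] by auto
  then show "\<exists>K. compact K \<and> (\<forall>x. x \<notin> K \<longrightarrow> norm (f x - g x) < e)"
    using K(1) L(1) by (intro exI[of _ "K \<union> L"]) auto
qed

lemma C0_bounded:
  assumes "f \<in> C0" shows "\<exists>B>0. \<forall>x. norm (f x) \<le> B"
proof -
  have "compact ((\<lambda>x. f x) ` {x. 1 \<le> norm (f x)})"
    by (intro compact_continuous_image C0_compact[OF assms]
        continuous_on_subset[OF C0_D(1)[OF assms]]) auto
  then have "bounded (f ` {x. 1 \<le> norm (f x)})" by (simp add: compact_imp_bounded)
  then obtain B where B: "\<forall>y\<in>f ` {x. 1 \<le> norm (f x)}. norm y \<le> B"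
    unfolding bounded_iff by blast
  have "norm (f x) \<le> max B 1" for x
    using B by (cases "1 \<le> norm (f x)") (auto simp: le_max_iff_disj)
  then show ?thesis by (intro exI[of _ "max B 1"]) auto
qed

context cstar_algebra
begin

lemma norm_selfadjoint_part_le: "norm ((1/2) *\<^sub>R (a + st a)) \<le> norm a"
  using norm_triangle_ineq[of a "st a"] by simp

text \<open>The spectrum of \<open>a * a\<close> consists of squares of real numbers, so its point
  of modulus \<open>norm a ^ 2\<close> is nonnegative. Through this identity a hypothesis on
  \<open>Mspec\<close> speaks about norms.\<close>

lemma Mspec_square:
  assumes a: "st a = a" shows "Mspec (a * a) = norm a ^ 2"
proof -
  obtain m where m: "m \<in> spec (a * a)" "cmod m = norm (a * a)"
    using norm_in_spec[of "a * a"] a by (auto simp: st_mult)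
  have "spec a \<noteq> {}" using norm_in_spec[OF a] by auto
  moreover have "poly_ev [:0, 0, 1:] a = a * a" by (simp add: scaleC_one)
  ultimately obtain l where l: "l \<in> spec a" "l * l = m"
    using spec_poly_ev[of m "[:0, 0, 1:]" a] m(1) by auto
  have "l = of_real (Re l)" using spec_selfadjoint_real[OF a l(1)] by (simp add: complex_eq_iff)
  then have "m = of_real (Re l * Re l)" using l(2) by (metis of_real_mult)
  then have "Re m = cmod m" by (simp only: Re_complex_of_real norm_of_real) simp
  then have "Re m = norm a ^ 2" using m(2) norm_sq_selfadjoint[OF a] by simp
  then have mem: "norm a ^ 2 \<in> Re ` spec (a * a)" using m(1) by force
  have "Re z \<le> norm a ^ 2" if "z \<in> spec (a * a)" for z
    using spec_norm_le[OF that] complex_Re_le_cmod[of z] norm_sq_selfadjoint[OF a] by simp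
  then show ?thesis unfolding Mspec_def by (intro cSup_eq_maximum mem) auto
qed

end

text \<open>\<open>separation\<close> is the alternative of (AX1) and (AX2) for all pairs of points.
  (AX0) concerns the degenerate points only and enters at the very end.\<close>

locale spectral_function_algebra = cstar_algebra st
  for st :: "'a::complex_banach_algebra_1 \<Rightarrow> 'a" +
  fixes E :: "('x::topological_space \<Rightarrow> 'a) set"
  assumes E: "star_subalgebra st E"
    and separation: "spectrally_separates st E x y \<or>
      (\<forall>f\<in>E. (\<forall>t. st (f t) = f t) \<longrightarrow> Mspec (f x) = Mspec (f y))"
begin

lemma E_C0: "f \<in> E \<Longrightarrow> f \<in> C0"
  and E_zero: "(\<lambda>_. 0) \<in> E"
  and E_add: "f \<in> E \<Longrightarrow> g \<in> E \<Longrightarrow> (\<lambda>x. f x + g x) \<in> E"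
  and E_mult: "f \<in> E \<Longrightarrow> g \<in> E \<Longrightarrow> (\<lambda>x. f x * g x) \<in> E"
  and E_scaleC: "f \<in> E \<Longrightarrow> (\<lambda>x. c *\<^sub>C f x) \<in> E"
  and E_st: "f \<in> E \<Longrightarrow> (\<lambda>x. st (f x)) \<in> E"
  using E by (auto simp: star_subalgebra_def)

lemma E_scaleR: "f \<in> E \<Longrightarrow> (\<lambda>x. r *\<^sub>R f x) \<in> E"
  using E_scaleC by (simp add: scaleR_scaleC)

lemma E_minus: "f \<in> E \<Longrightarrow> (\<lambda>x. - f x) \<in> E"
  using E_scaleC[of f "-1"] by (simp add: scaleC_minus_one)

lemma E_diff: "f \<in> E \<Longrightarrow> g \<in> E \<Longrightarrow> (\<lambda>x. f x - g x) \<in> E"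
  using E_add[OF _ E_minus, of f g] by simp

lemma E_sum: "(\<And>i. i \<in> I \<Longrightarrow> f i \<in> E) \<Longrightarrow> (\<lambda>x. \<Sum>i\<in>I. f i x) \<in> E"
  by (induction I rule: infinite_finite_induct) (auto intro: E_zero E_add)

lemma E_continuous: "f \<in> E \<Longrightarrow> continuous_on UNIV f"
  using E_C0 C0_D by blast

lemma E_rpoly_ev:
  assumes f: "f \<in> E" shows "(\<lambda>x. rpoly_ev (pCons 0 p) (f x)) \<in> E"
proof (induction p)
  case 0
  show ?case using E_zero by simp
next
  case (pCons c p)
  have "(\<lambda>x. c *\<^sub>R f x + f x * rpoly_ev (pCons 0 p) (f x)) \<in> E"
    by (intro E_add E_scaleR E_mult f pCons.IH)
  then show ?case by (simp add: distrib_left)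
qed

text \<open>A ramp from \<open>0\<close> at \<open>\<alpha>\<close> to \<open>1\<close> at
  \<open>\<beta>\<close> is approximated by a polynomial without constant term. The two conditions
  on \<open>h x\<close> locate its spectrum in \<open>[\<beta>, 2 - \<beta>]\<close> or in
  \<open>[-\<alpha>, \<alpha>]\<close>, where the ramp is constant.\<close>

lemma E_cutoff:
  assumes h: "h \<in> E" "\<And>x. st (h x) = h x" and ab: "0 \<le> \<alpha>" "\<alpha> < \<beta>" and d: "\<delta> > 0"
  shows "\<exists>g\<in>E. \<forall>x. (norm (h x - 1) \<le> 1 - \<beta> \<longrightarrow> norm (g x - 1) \<le> \<delta>) \<and>
           (norm (h x) \<le> \<alpha> \<longrightarrow> norm (g x) \<le> \<delta>) \<and> norm (g x) \<le> 1 + \<delta>"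
proof -
  obtain B where B: "B > 0" "\<And>x. norm (h x) \<le> B" using C0_bounded[OF E_C0[OF h(1)]] by blast
  \<comment> \<open>Large enough for the three intervals on which the approximation is used:
    \<open>[-B, B]\<close>, \<open>[-\<alpha>, \<alpha>]\<close> and
    \<open>[\<beta>, 2 - \<beta>]\<close>.\<close>
  define R where "R = B + \<alpha> + \<bar>2 - \<beta>\<bar> + \<bar>\<beta>\<bar>"
  define f where "f t = max 0 (min 1 ((t - \<alpha>) / (\<beta> - \<alpha>)))" for t
  have f0: "f t = 0" if "t \<le> \<alpha>" for t using that ab by (simp add: f_def divide_nonpos_pos)
  have f1: "f t = 1" if "t \<ge> \<beta>" for t using that ab by (simp add: f_def)
  have fb: "\<bar>f t\<bar> \<le> 1" for t by (simp add: f_def)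
  have "continuous_on UNIV f" unfolding f_def by (rule continuous_on_cutoff)
  then obtain p where p: "\<And>t. \<bar>t\<bar> \<le> R \<Longrightarrow> \<bar>poly (pCons 0 p) t - f t\<bar> < \<delta>"
    using real_poly_approximation_vanishing[of f \<delta> R] d f0[of 0] ab B(1) by (auto simp: R_def)
  define g where "g x = rpoly_ev (pCons 0 p) (h x)" for x
  have "g \<in> E" unfolding g_def using E_rpoly_ev h(1) by blast
  moreover have "norm (g x - 1) \<le> \<delta>" if x: "norm (h x - 1) \<le> 1 - \<beta>" for x
  proof -
    have "norm (rpoly_ev (pCons 0 p - 1) (h x)) \<le> \<delta>"
    proof (rule norm_rpoly_ev_le_interval[OF h(2), of _ 1])
      show "norm (h x - 1 *\<^sub>R 1) \<le> 1 - \<beta>" using x by simp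
      fix t :: real assume t: "\<bar>t - 1\<bar> \<le> 1 - \<beta>"
      then have "f t = 1" by (intro f1) linarith
      moreover have "\<bar>t\<bar> \<le> R" using t ab B(1) by (simp add: R_def)
      ultimately show "\<bar>poly (pCons 0 p - 1) t\<bar> \<le> \<delta>" using p[of t] by simp
    qed
    then show ?thesis by (simp add: g_def rpoly_ev_diff)
  qed
  moreover have "norm (g x) \<le> \<delta>" if x: "norm (h x) \<le> \<alpha>" for x
    unfolding g_def
  proof (rule norm_rpoly_ev_le_interval[OF h(2), of _ 0])
    show "norm (h x - 0 *\<^sub>R 1) \<le> \<alpha>" using x by simp
    fix t :: real assume t: "\<bar>t - 0\<bar> \<le> \<alpha>"
    then have "f t = 0" by (intro f0) linarith
    moreover have "\<bar>t\<bar> \<le> R" using t ab B(1) by (simp add: R_def)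
    ultimately show "\<bar>poly (pCons 0 p) t\<bar> \<le> \<delta>" using p[of t] by simp
  qed
  moreover have "norm (g x) \<le> 1 + \<delta>" for x
    unfolding g_def
  proof (rule norm_rpoly_ev_le_interval[OF h(2), of _ 0])
    show "norm (h x - 0 *\<^sub>R 1) \<le> B" using B by simp
    fix t :: real assume t: "\<bar>t - 0\<bar> \<le> B"
    then have "\<bar>t\<bar> \<le> R" using ab by (simp add: R_def)
    then show "\<bar>poly (pCons 0 p) t\<bar> \<le> 1 + \<delta>" using p[of t] fb[of t] by linarith
  qed
  ultimately show ?thesis by blast
qed

text \<open>Directed on purpose, since without a unit in \<open>E\<close> the two sets cannot be
  exchanged by passing to \<open>1 - h\<close>. The gap between \<open>1/4\<close> and
  \<open>3/4\<close> leaves room for a ramp, so that \<open>1/4\<close> can be improved to any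
  positive bound.\<close>

definition approx_sep :: "'x set \<Rightarrow> 'x set \<Rightarrow> bool" where
  "approx_sep U V \<longleftrightarrow>
     (\<exists>h\<in>E. (\<forall>x\<in>U. norm (h x - 1) \<le> 1/4) \<and> (\<forall>x\<in>V. norm (h x) \<le> 1/4))"

lemma approx_sepI:
  "h \<in> E \<Longrightarrow> (\<And>x. x \<in> U \<Longrightarrow> norm (h x - 1) \<le> 1/4) \<Longrightarrow>
   (\<And>x. x \<in> V \<Longrightarrow> norm (h x) \<le> 1/4) \<Longrightarrow> approx_sep U V"
  unfolding approx_sep_def by blast

text \<open>The selfadjoint part of \<open>h\<close> is no farther from \<open>1\<close> or
  \<open>0\<close> than \<open>h\<close> is, and \<open>E_cutoff\<close> with
  \<open>\<alpha> = 1/4\<close>, \<open>\<beta> = 3/4\<close> applies to it. The global bound gained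
  here is what keeps products of such elements under control.\<close>

lemma approx_sep_sharpen:
  assumes "approx_sep U V" "\<delta> > 0"
  shows "\<exists>h\<in>E. (\<forall>x\<in>U. norm (h x - 1) \<le> \<delta>) \<and> (\<forall>x\<in>V. norm (h x) \<le> \<delta>) \<and> (\<forall>x. norm (h x) \<le> 1 + \<delta>)"
proof -
  obtain h where h: "h \<in> E" "\<And>x. x \<in> U \<Longrightarrow> norm (h x - 1) \<le> 1/4"
    "\<And>x. x \<in> V \<Longrightarrow> norm (h x) \<le> 1/4" using assms(1) by (auto simp: approx_sep_def)
  define k where "k x = (1/2) *\<^sub>R (h x + st (h x))" for x
  have k: "k \<in> E" unfolding k_def by (intro E_scaleR E_add E_st h)
  have sa: "st (k x) = k x" for x by (simp add: k_def st_scaleR st_add add.commute)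
  have "k x - 1 = (1/2) *\<^sub>R (h x + st (h x)) - (1/2) *\<^sub>R (1 + 1)" for x
    unfolding k_def by (simp only: scaleR_half_double)
  then have "k x - 1 = (1/2) *\<^sub>R ((h x - 1) + st (h x - 1))" for x
    by (simp only: scaleR_right_diff_distrib[symmetric] st_diff st_one) (simp add: algebra_simps)
  then have n1: "norm (k x - 1) \<le> norm (h x - 1)" for x
    using norm_selfadjoint_part_le[of "h x - 1"] by simp
  have k1: "norm (k x - 1) \<le> 1 - 3/4" if "x \<in> U" for x
    using n1[of x] h(2)[OF that] by linarith
  have n2: "norm (k x) \<le> norm (h x)" for x
    using norm_selfadjoint_part_le[of "h x"] by (simp add: k_def)
  have k2: "norm (k x) \<le> 1/4" if "x \<in> V" for x
    using n2[of x] h(3)[OF that] by linarith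
  have "\<exists>g\<in>E. \<forall>x. (norm (k x - 1) \<le> 1 - 3/4 \<longrightarrow> norm (g x - 1) \<le> \<delta>) \<and>
      (norm (k x) \<le> 1/4 \<longrightarrow> norm (g x) \<le> \<delta>) \<and> norm (g x) \<le> 1 + \<delta>"
    by (rule E_cutoff[OF k sa _ _ assms(2)]) auto
  then show ?thesis using k1 k2 by meson
qed

lemma approx_sepE:
  assumes "approx_sep U V"
  obtains h where "h \<in> E" "\<forall>x\<in>U. norm (h x - 1) \<le> 1/16"
    "\<forall>x\<in>V. norm (h x) \<le> 1/16" "\<forall>x. norm (h x) \<le> 1 + 1/16"
proof -
  have "(1/16::real) > 0" by simp
  from approx_sep_sharpen[OF assms this] show ?thesis using that by blast
qed

lemma approx_sep_mono: "approx_sep U V \<Longrightarrow> U' \<subseteq> U \<Longrightarrow> V' \<subseteq> V \<Longrightarrow> approx_sep U' V'"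
  unfolding approx_sep_def by blast

lemma approx_sep_empty: "approx_sep {} V"
  by (rule approx_sepI[OF E_zero]) auto

text \<open>The product \<open>h k\<close> is small as soon as one factor is, because the other
  never exceeds \<open>17/16\<close> in norm.\<close>

lemma approx_sep_Int:
  assumes "approx_sep U V" "approx_sep U' V'" shows "approx_sep (U \<inter> U') (V \<union> V')"
proof -
  obtain h where h: "h \<in> E" "\<forall>x\<in>U. norm (h x - 1) \<le> 1/16"
    "\<forall>x\<in>V. norm (h x) \<le> 1/16" "\<forall>x. norm (h x) \<le> 1 + 1/16"
    by (rule approx_sepE[OF assms(1)])
  obtain k where k: "k \<in> E" "\<forall>x\<in>U'. norm (k x - 1) \<le> 1/16"
    "\<forall>x\<in>V'. norm (k x) \<le> 1/16" "\<forall>x. norm (k x) \<le> 1 + 1/16"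
    by (rule approx_sepE[OF assms(2)])
  show ?thesis
  proof (rule approx_sepI[OF E_mult[OF h(1) k(1)]])
    fix x assume x: "x \<in> U \<inter> U'"
    have "norm (h x * k x - 1) = norm ((h x - 1) * k x + (k x - 1))" by (simp add: algebra_simps)
    also have "\<dots> \<le> norm (h x - 1) * norm (k x) + norm (k x - 1)"
      by (intro norm_triangle_le add_mono norm_mult_ineq order_refl)
    also have "\<dots> \<le> (1/16) * (1 + 1/16) + 1/16"
      using h k x by (intro add_mono mult_mono) auto
    finally show "norm (h x * k x - 1) \<le> 1/4" by simp
  next
    fix x assume x: "x \<in> V \<union> V'"
    have "norm (h x * k x) \<le> norm (h x) * norm (k x)" by (rule norm_mult_ineq)
    also have "\<dots> \<le> (1 + 1/16) * (1/16)"
    proof (cases "x \<in> V")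
      case True
      then have "norm (h x) * norm (k x) \<le> (1/16) * (1 + 1/16)" using h k by (intro mult_mono) auto
      then show ?thesis by simp
    next
      case False
      then show ?thesis using x h k by (intro mult_mono) auto
    qed
    finally show "norm (h x * k x) \<le> 1/4" by simp
  qed
qed

text \<open>\<open>h + k - h k\<close> is \<open>1 - (1 - h)(1 - k)\<close>; the unit cancels, so
  the expression stays in \<open>E\<close>.\<close>

lemma approx_sep_Un:
  assumes "approx_sep U V" "approx_sep U' V" shows "approx_sep (U \<union> U') V"
proof -
  obtain h where h: "h \<in> E" "\<forall>x\<in>U. norm (h x - 1) \<le> 1/16"
    "\<forall>x\<in>V. norm (h x) \<le> 1/16" "\<forall>x. norm (h x) \<le> 1 + 1/16"
    by (rule approx_sepE[OF assms(1)])
  obtain k where k: "k \<in> E" "\<forall>x\<in>U'. norm (k x - 1) \<le> 1/16"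
    "\<forall>x\<in>V. norm (k x) \<le> 1/16" "\<forall>x. norm (k x) \<le> 1 + 1/16"
    by (rule approx_sepE[OF assms(2)])
  have h1: "norm (h x - 1) \<le> 3" and k1: "norm (k x - 1) \<le> 3" for x
    using norm_triangle_ineq4[of "h x" 1] norm_triangle_ineq4[of "k x" 1] h(4)[rule_format, of x] k(4)[rule_format, of x]
    by auto
  show ?thesis
  proof (rule approx_sepI[OF E_diff[OF E_add[OF h(1) k(1)] E_mult[OF h(1) k(1)]]])
    fix x assume x: "x \<in> U \<union> U'"
    have "norm (h x + k x - h x * k x - 1) = norm ((h x - 1) * (k x - 1))"
      by (subst norm_minus_cancel[symmetric]) (simp add: algebra_simps)
    also have "\<dots> \<le> norm (h x - 1) * norm (k x - 1)" by (rule norm_mult_ineq)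
    also have "\<dots> \<le> 3 * (1/16)"
    proof (cases "x \<in> U")
      case True
      then have "norm (h x - 1) * norm (k x - 1) \<le> (1/16) * 3" using h k1 by (intro mult_mono) auto
      then show ?thesis by simp
    next
      case False
      then show ?thesis using x h1 k by (intro mult_mono) auto
    qed
    finally show "norm (h x + k x - h x * k x - 1) \<le> 1/4" by simp
  next
    fix x assume x: "x \<in> V"
    have "norm (h x + k x - h x * k x) \<le> norm (h x) + norm (k x) + norm (h x) * norm (k x)"
      by (intro norm_triangle_le_diff add_mono norm_triangle_ineq norm_mult_ineq)
    also have "\<dots> \<le> 1/16 + 1/16 + (1/16) * (1/16)"
      using h k x by (intro add_mono mult_mono) auto
    finally show "norm (h x + k x - h x * k x) \<le> 1/4" by simp
  qed
qed

text \<open>\<open>k - k h\<close> is \<open>k (1 - h)\<close>: on \<open>U'\<close> the element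
  \<open>k\<close> acts as the missing unit, so the direction can be reversed there.\<close>

lemma approx_sep_flip:
  assumes "approx_sep U V" "approx_sep U' V'" shows "approx_sep (U' \<inter> V) U"
proof -
  obtain h where h: "h \<in> E" "\<forall>x\<in>U. norm (h x - 1) \<le> 1/16"
    "\<forall>x\<in>V. norm (h x) \<le> 1/16" "\<forall>x. norm (h x) \<le> 1 + 1/16"
    by (rule approx_sepE[OF assms(1)])
  obtain k where k: "k \<in> E" "\<forall>x\<in>U'. norm (k x - 1) \<le> 1/16"
    "\<forall>x\<in>V'. norm (k x) \<le> 1/16" "\<forall>x. norm (k x) \<le> 1 + 1/16"
    by (rule approx_sepE[OF assms(2)])
  show ?thesis
  proof (rule approx_sepI[OF E_diff[OF k(1) E_mult[OF k(1) h(1)]]])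
    fix x assume x: "x \<in> U' \<inter> V"
    have "norm (k x - k x * h x - 1) = norm ((k x - 1) - k x * h x)" by (simp add: algebra_simps)
    also have "\<dots> \<le> norm (k x - 1) + norm (k x) * norm (h x)"
      by (intro norm_triangle_le_diff add_mono norm_mult_ineq order_refl)
    also have "\<dots> \<le> 1/16 + (1 + 1/16) * (1/16)"
      using h k x by (intro add_mono mult_mono) auto
    finally show "norm (k x - k x * h x - 1) \<le> 1/4" by simp
  next
    fix x assume x: "x \<in> U"
    have "norm (k x - k x * h x) = norm (k x * (h x - 1))"
      by (subst norm_minus_cancel[symmetric]) (simp add: algebra_simps)
    also have "\<dots> \<le> norm (k x) * norm (h x - 1)" by (rule norm_mult_ineq)
    also have "\<dots> \<le> (1 + 1/16) * (1/16)" using h k x by (intro mult_mono) auto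
    finally show "norm (k x - k x * h x) \<le> 1/4" by simp
  qed
qed

lemma approx_sep_open:
  assumes "approx_sep U V"
  shows "\<exists>U' V'. open U' \<and> open V' \<and> U \<subseteq> U' \<and> V \<subseteq> V' \<and> approx_sep U' V'"
proof -
  obtain h where h: "h \<in> E" "\<forall>x\<in>U. norm (h x - 1) \<le> 1/16" "\<forall>x\<in>V. norm (h x) \<le> 1/16" "\<forall>x. norm (h x) \<le> 1 + 1/16"
    by (rule approx_sepE[OF assms])
  show ?thesis
  proof (intro exI conjI)
    show "open {x. norm (h x - 1) < 1/4}" "open {x. norm (h x) < 1/4}"
      by (intro open_Collect_less continuous_intros E_continuous[OF h(1)])+
    show "U \<subseteq> {x. norm (h x - 1) < 1/4}"
    proof
      fix x assume "x \<in> U"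
      with h(2) have "norm (h x - 1) \<le> 1/16" by blast
      then show "x \<in> {x. norm (h x - 1) < 1/4}" by simp
    qed
    show "V \<subseteq> {x. norm (h x) < 1/4}"
    proof
      fix x assume "x \<in> V"
      with h(3) have "norm (h x) \<le> 1/16" by blast
      then show "x \<in> {x. norm (h x) < 1/4}" by simp
    qed
    show "approx_sep {x. norm (h x - 1) < 1/4} {x. norm (h x) < 1/4}"
      by (rule approx_sepI[OF h(1)]) auto
  qed
qed

end

section \<open>Degenerate and equivalent points\<close>

context cstar_algebra
begin

lemma continuous_on_st: "continuous_on S f \<Longrightarrow> continuous_on S (\<lambda>x. st (f x))"
  unfolding continuous_on_def using tendsto_st by blast

lemma continuous_on_scaleC: "continuous_on S f \<Longrightarrow> continuous_on S (\<lambda>x. c *\<^sub>C (f x :: 'a))"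
  unfolding continuous_on_def using tendsto_scaleC[OF tendsto_const] by blast

lemma pair_algebra_closure:
  assumes one: "(1, 1) \<in> S"
    and add: "\<And>u v. u \<in> S \<Longrightarrow> v \<in> S \<Longrightarrow> (fst u + fst v, snd u + snd v) \<in> S"
    and mult: "\<And>u v. u \<in> S \<Longrightarrow> v \<in> S \<Longrightarrow> (fst u * fst v, snd u * snd v) \<in> S"
    and scale: "\<And>c u. u \<in> S \<Longrightarrow> (c *\<^sub>C fst u, c *\<^sub>C snd u) \<in> S"
    and star: "\<And>u. u \<in> S \<Longrightarrow> (st (fst u), st (snd u)) \<in> S"
  shows "pair_algebra (closure S)"
proof -
  have binop: "g (u, v) \<in> closure S"
    if g: "continuous_on UNIV g" "\<And>u v. u \<in> S \<Longrightarrow> v \<in> S \<Longrightarrow> g (u, v) \<in> S"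
      and uv: "u \<in> closure S" "v \<in> closure S"
    for g :: "('a \<times> 'a) \<times> ('a \<times> 'a) \<Rightarrow> 'a \<times> 'a" and u v
  proof -
    have "g ` closure (S \<times> S) \<subseteq> closure S"
      by (rule image_closure_subset[OF continuous_on_subset[OF g(1)]])
        (use g(2) closure_subset in fastforce)+
    then show ?thesis using uv by (auto simp: closure_Times)
  qed
  have unop: "g u \<in> closure S"
    if g: "continuous_on UNIV g" "\<And>u. u \<in> S \<Longrightarrow> g u \<in> S" and u: "u \<in> closure S"
    for g :: "'a \<times> 'a \<Rightarrow> 'a \<times> 'a" and u
  proof -
    have "g ` closure S \<subseteq> closure S"
      by (rule image_closure_subset[OF continuous_on_subset[OF g(1)]])
        (use g(2) closure_subset in fastforce)+
    then show ?thesis using u by auto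
  qed
  show ?thesis unfolding pair_algebra_def
  proof (intro conjI allI impI)
    show "closed (closure S)" by simp
    show "(1, 1) \<in> closure S" using one closure_subset by blast
    fix a b assume ab: "(a, b) \<in> closure S"
    show "(c *\<^sub>C a, c *\<^sub>C b) \<in> closure S" for c
      using unop[of "\<lambda>u. (c *\<^sub>C fst u, c *\<^sub>C snd u)" "(a, b)"] ab scale
      by (simp add: continuous_on_Pair continuous_on_scaleC continuous_intros)
    show "(st a, st b) \<in> closure S"
      using unop[of "\<lambda>u. (st (fst u), st (snd u))" "(a, b)"] ab star
      by (simp add: continuous_on_Pair continuous_on_st continuous_intros)
    fix c d assume cd: "(c, d) \<in> closure S"
    show "(a + c, b + d) \<in> closure S"
      using binop[of "\<lambda>w. (fst (fst w) + fst (snd w), snd (fst w) + snd (snd w))" "(a, b)" "(c, d)"] ab cd add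
      by (simp add: continuous_intros)
    show "(a * c, b * d) \<in> closure S"
      using binop[of "\<lambda>w. (fst (fst w) * fst (snd w), snd (fst w) * snd (snd w))" "(a, b)" "(c, d)"] ab cd mult
      by (simp add: continuous_intros)
  qed
qed

end

context spectral_function_algebra
begin

definition degenerate :: "'x set" where
  "degenerate = {x. \<forall>f\<in>E. \<not> invertible_el (f x)}"

definition eqv :: "'x \<Rightarrow> 'x \<Rightarrow> bool" where
  "eqv x y \<longleftrightarrow> (\<forall>f\<in>E. norm (f x) = norm (f y)) \<and> (x \<in> degenerate \<longleftrightarrow> y \<in> degenerate)"

lemma eqv_sym: "eqv x y \<Longrightarrow> eqv y x"
  by (auto simp: eqv_def)

text \<open>The square of \<open>st f * f\<close>, divided by its norm at \<open>x\<close>, has at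
  \<open>x\<close> a spectrum bounded away from \<open>0\<close> inside \<open>(0, 1]\<close>, hence
  lies at distance less than \<open>1\<close> from the unit. This form of invertibility is one that
  \<open>E_cutoff\<close> can use.\<close>

lemma nondegenerateE:
  assumes "x \<notin> degenerate"
  obtains h where "h \<in> E" "\<forall>t. st (h t) = h t" "norm (h x - 1) < 1"
proof -
  obtain f where f: "f \<in> E" "invertible_el (f x)" using assms by (auto simp: degenerate_def)
  define k where "k t = st (f t) * f t" for t
  have k: "k \<in> E" unfolding k_def by (intro E_mult E_st f)
  have sa: "st (k t) = k t" for t by (simp add: k_def st_mult)
  have inv: "invertible_el (k x)" by (simp add: k_def invertible_el_mult invertible_el_st f)
  define h where "h t = (1 / norm (k x) ^ 2) *\<^sub>R (k t * k t)" for t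
  have "h \<in> E" unfolding h_def by (intro E_scaleR E_mult k)
  moreover have "\<forall>t. st (h t) = h t" by (simp add: h_def st_scaleR st_mult sa)
  moreover have "norm (h x - 1) < 1"
    using norm_one_minus_square_lt[OF sa inv] by (simp add: h_def norm_minus_commute)
  ultimately show ?thesis by (rule that)
qed

lemma closed_degenerate: "closed degenerate"
proof -
  have "open (- degenerate)"
  proof (subst open_subopen, intro ballI)
    fix x assume "x \<in> - degenerate"
    then obtain h where h: "h \<in> E" "\<forall>t. st (h t) = h t" "norm (h x - 1) < 1"
      using nondegenerateE by blast
    have "open {t. norm (h t - 1) < 1}"
      by (intro open_Collect_less continuous_intros E_continuous[OF h(1)])
    moreover have "{t. norm (h t - 1) < 1} \<subseteq> - degenerate"
      using h(1) invertible_el_near_one by (auto simp: degenerate_def)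
    ultimately show "\<exists>T. open T \<and> x \<in> T \<and> T \<subseteq> - degenerate" using h(3) by blast
  qed
  then show ?thesis by (simp add: closed_def)
qed

text \<open>(AX2) is applied to the square of \<open>st f * f\<close>, for which
  \<open>Mspec\<close> is the fourth power of the norm of \<open>f\<close>.\<close>

lemma Mspec_eq_imp_norm_eq:
  assumes M: "\<forall>f\<in>E. (\<forall>t. st (f t) = f t) \<longrightarrow> Mspec (f x) = Mspec (f y)" and f: "f \<in> E"
  shows "norm (f x) = norm (f y)"
proof -
  define k where "k t = st (f t) * f t" for t
  have k: "k \<in> E" unfolding k_def by (intro E_mult E_st f)
  have sa: "st (k t) = k t" for t by (simp add: k_def st_mult)
  have "(\<lambda>t. k t * k t) \<in> E" by (intro E_mult k)
  from bspec[OF M this] have "Mspec (k x * k x) = Mspec (k y * k y)" by (simp add: st_mult sa)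
  then have "(norm (f x) ^ 2) ^ 2 = (norm (f y) ^ 2) ^ 2"
    by (simp add: Mspec_square[OF sa]) (simp add: k_def norm_st_mult)
  then show ?thesis by (metis norm_ge_zero power2_eq_imp_eq zero_le_power2)
qed

text \<open>Equal norms do not detect invertibility, so the sign of \<open>Mspec\<close> is used:
  for \<open>h x\<close> at distance less than \<open>1\<close> from the unit,
  \<open>Mspec (- h x)\<close> is negative, and (AX2) pushes the spectrum of \<open>- h y\<close> to
  the left of \<open>0\<close>.\<close>

lemma Mspec_eq_imp_nondegenerate:
  assumes M: "\<forall>f\<in>E. (\<forall>t. st (f t) = f t) \<longrightarrow> Mspec (f x) = Mspec (f y)" and x: "x \<notin> degenerate"
  shows "y \<notin> degenerate"
proof -
  obtain h where h: "h \<in> E" "\<forall>t. st (h t) = h t" "norm (h x - 1) < 1"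
    using nondegenerateE[OF x] by blast
  have mh: "(\<lambda>t. - h t) \<in> E" using E_minus h by blast
  have sa: "st (- h t) = - h t" for t
    using st_scaleR[of "-1" "h t"] h(2) by simp
  have "spec (- h x) \<noteq> {}" using norm_in_spec[OF sa] by blast
  moreover have "Re l \<le> norm (h x - 1) - 1" if "l \<in> spec (- h x)" for l
  proof -
    have "cmod (l - (-1)) \<le> norm (- h x - (-1) *\<^sub>C 1)" by (rule spec_dist_le[OF that])
    then have "cmod (l + 1) \<le> norm (h x - 1)"
      by (simp add: scaleC_minus_one norm_minus_commute add.commute)
    moreover have "Re (l + 1) \<le> cmod (l + 1)" by (rule complex_Re_le_cmod)
    ultimately show ?thesis by simp
  qed
  ultimately have "Mspec (- h x) \<le> norm (h x - 1) - 1"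
    unfolding Mspec_def by (intro cSup_least) auto
  then have neg: "Mspec (- h y) < 0" using M mh sa h(3) by fastforce
  have "0 \<notin> spec (- h y)"
  proof
    assume "0 \<in> spec (- h y)"
    then have "0 \<in> Re ` spec (- h y)" by force
    then have "0 \<le> Mspec (- h y)" unfolding Mspec_def by (intro cSup_upper bdd_above_Re_spec)
    with neg show False by simp
  qed
  then have "invertible_el (- h y)" by (simp add: zero_in_spec_iff)
  then show ?thesis using mh by (auto simp: degenerate_def)
qed

lemma eqv_or_disjoint_spectra: "eqv x y \<or> (\<exists>f\<in>E. spec (f x) \<inter> spec (f y) = {})"
proof (cases "spectrally_separates st E x y")
  case True
  then show ?thesis by (auto simp: spectrally_separates_def)
next
  case False
  then have M: "\<forall>f\<in>E. (\<forall>t. st (f t) = f t) \<longrightarrow> Mspec (f x) = Mspec (f y)"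
    using separation by blast
  then have M': "\<forall>f\<in>E. (\<forall>t. st (f t) = f t) \<longrightarrow> Mspec (f y) = Mspec (f x)" by simp
  show ?thesis
    using Mspec_eq_imp_norm_eq[OF M] Mspec_eq_imp_nondegenerate[OF M] Mspec_eq_imp_nondegenerate[OF M']
    by (auto simp: eqv_def)
qed

text \<open>At degenerate points \<open>0\<close> belongs to every spectrum, so no element of
  \<open>E\<close> can have disjoint spectra there.\<close>

lemma degenerate_eqv: assumes "x \<in> degenerate" "y \<in> degenerate" shows "eqv x y"
proof -
  have "0 \<in> spec (f x) \<inter> spec (f y)" if "f \<in> E" for f
    using assms that by (auto simp: degenerate_def zero_in_spec_iff)
  then show ?thesis using eqv_or_disjoint_spectra[of x y] by blast
qed

text \<open>The quadratic \<open>t (t - b) / (a (a - b))\<close> maps \<open>a\<close> to \<open>1\<close> and \<open>b\<close> to \<open>0\<close> and vanishes at \<open>0\<close>.\<close>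

lemma approx_sep_scalar_values:
  assumes f: "f \<in> E" and fx: "norm (f x - a *\<^sub>C 1) \<le> 1/16" and fy: "norm (f y - b *\<^sub>C 1) \<le> 1/16"
    and ab: "cmod (a - b) = 1" "cmod a \<ge> 1/2"
  shows "approx_sep {x} {y}"
proof -
  define s where "s = a - b"
  define c where "c = 1 / (a * s)"
  have nz: "a \<noteq> 0" "s \<noteq> 0" using ab by (auto simp: s_def)
  have "cmod c = 1 / cmod a" using ab(1) by (simp add: c_def norm_divide norm_mult flip: s_def)
  also have "\<dots> \<le> 2" using ab(2) nz by (simp add: field_simps)
  finally have c2: "cmod c \<le> 2" .
  define p where "p = f x - a *\<^sub>C 1"
  define r where "r = f y - b *\<^sub>C 1"
  have e: "f x = a *\<^sub>C 1 + p" "f y = b *\<^sub>C 1 + r" by (auto simp: p_def r_def)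
  have pr: "norm p \<le> 1/16" "norm r \<le> 1/16" using fx fy by (auto simp: p_def r_def)
  define g where "g t = c *\<^sub>C (f t * f t - b *\<^sub>C f t)" for t
  have gE: "g \<in> E" unfolding g_def by (intro E_scaleC E_diff E_mult f)
  have bs: "b = a - s" by (simp add: s_def)
  have "f x * f x - b *\<^sub>C f x = (a * s) *\<^sub>C 1 + ((a + s) *\<^sub>C p + p * p)"
    unfolding e(1) bs
    by (simp add: algebra_simps mult_scaleC_left mult_scaleC_right scaleC_scaleC scaleC_add_right
        scaleC_add_left scaleC_diff_left)
  then have "g x - 1 = c *\<^sub>C ((a + s) *\<^sub>C p + p * p)"
    using nz by (simp add: g_def scaleC_add_right scaleC_scaleC c_def scaleC_one)
  then have "norm (g x - 1) \<le> norm ((c * (a + s)) *\<^sub>C p) + norm (c *\<^sub>C (p * p))"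
    by (simp add: scaleC_add_right scaleC_scaleC norm_triangle_ineq)
  also have "\<dots> \<le> 3 * (1/16) + 2 * ((1/16) * (1/16))"
  proof (rule add_mono)
    \<comment> \<open>In this form the coefficient is at most \<open>1 + 2\<close>, and the total
      error \<open>3/16 + 2/256\<close> is below \<open>1/4\<close>.\<close>
    have "c * (a + s) = 1 / s + c * s" using nz by (simp add: c_def field_simps)
    then have "cmod (c * (a + s)) \<le> 3"
      using norm_triangle_ineq[of "1/s" "c * s"] c2 ab by (simp add: s_def norm_divide norm_mult)
    then show "norm ((c * (a + s)) *\<^sub>C p) \<le> 3 * (1/16)"
      unfolding norm_scaleC using pr by (intro mult_mono) auto
    have "norm (p * p) \<le> (1/16) * (1/16)"
      using norm_mult_ineq[of p p] mult_mono[OF pr(1) pr(1)] by simp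
    then show "norm (c *\<^sub>C (p * p)) \<le> 2 * ((1/16) * (1/16))"
      unfolding norm_scaleC using c2 by (intro mult_mono) auto
  qed
  finally have gx: "norm (g x - 1) \<le> 1/4" by simp
  have "f y * f y - b *\<^sub>C f y = b *\<^sub>C r + r * r"
    unfolding e
    by (simp add: algebra_simps mult_scaleC_left mult_scaleC_right scaleC_scaleC scaleC_add_right)
  then have "norm (g y) \<le> norm ((c * b) *\<^sub>C r) + norm (c *\<^sub>C (r * r))"
    by (simp add: g_def scaleC_add_right scaleC_scaleC norm_triangle_ineq)
  also have "\<dots> \<le> 3 * (1/16) + 2 * ((1/16) * (1/16))"
  proof (rule add_mono)
    have "c * b = 1 / s - c * s" using nz by (simp add: c_def bs field_simps)
    then have "cmod (c * b) \<le> 3"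
      using norm_triangle_ineq4[of "1/s" "c * s"] c2 ab by (simp add: s_def norm_divide norm_mult)
    then show "norm ((c * b) *\<^sub>C r) \<le> 3 * (1/16)"
      unfolding norm_scaleC using pr by (intro mult_mono) auto
    have "norm (r * r) \<le> (1/16) * (1/16)"
      using norm_mult_ineq[of r r] mult_mono[OF pr(2) pr(2)] by simp
    then show "norm (c *\<^sub>C (r * r)) \<le> 2 * ((1/16) * (1/16))"
      unfolding norm_scaleC using c2 by (intro mult_mono) auto
  qed
  finally have gy: "norm (g y) \<le> 1/4" by simp
  show ?thesis by (rule approx_sepI[OF gE]) (use gx gy in auto)
qed

text \<open>With scalars adjoined to the pairs \<open>(g x, g y)\<close>, the closure contains
  \<open>(1, 0)\<close>. So some \<open>g\<close> is near \<open>1 - m\<close> at \<open>x\<close>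
  and near \<open>- m\<close> at \<open>y\<close>. These scalars differ by \<open>1\<close>, hence
  one of them has modulus at least \<open>1/2\<close> and can be sent to \<open>1\<close> while the
  other goes to \<open>0\<close>; which one it is decides the direction of the separation.\<close>

lemma disjoint_spectra_approx_sep:
  assumes f: "f \<in> E" and disj: "spec (f x) \<inter> spec (f y) = {}"
  shows "approx_sep {x} {y} \<or> approx_sep {y} {x}"
proof -
  define S where "S = {(g x + m *\<^sub>C 1, g y + m *\<^sub>C 1) | g m. g \<in> E}"
  have SI: "(g x + m *\<^sub>C 1, g y + m *\<^sub>C 1) \<in> S" if "g \<in> E" for g m
    using that by (auto simp: S_def)
  have SE: "\<exists>g m. g \<in> E \<and> u = (g x + m *\<^sub>C 1, g y + m *\<^sub>C 1)" if "u \<in> S" for u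
    using that by (auto simp: S_def)
  have "pair_algebra (closure S)"
  proof (rule pair_algebra_closure)
    show "(1, 1) \<in> S" using SI[OF E_zero, of 1] by (simp add: scaleC_one)
    fix u v c assume u: "u \<in> S"
    obtain g m where g: "g \<in> E" "u = (g x + m *\<^sub>C 1, g y + m *\<^sub>C 1)" using SE[OF u] by blast
    show "(c *\<^sub>C fst u, c *\<^sub>C snd u) \<in> S"
      using SI[OF E_scaleC[OF g(1)], of c "c * m"] by (simp add: g(2) scaleC_add_right scaleC_scaleC)
    show "(st (fst u), st (snd u)) \<in> S"
      using SI[OF E_st[OF g(1)], of "cnj m"] by (simp add: g(2) st_add st_scaleC)
    assume v: "v \<in> S"
    obtain h n where h: "h \<in> E" "v = (h x + n *\<^sub>C 1, h y + n *\<^sub>C 1)" using SE[OF v] by blast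
    show "(fst u + fst v, snd u + snd v) \<in> S"
      using SI[OF E_add[OF g(1) h(1)], of "m + n"] by (simp add: g(2) h(2) scaleC_add_left algebra_simps)
    have "(\<lambda>t. g t * h t + (m *\<^sub>C h t + n *\<^sub>C g t)) \<in> E" by (intro E_add E_mult E_scaleC g h)
    from SI[OF this, of "m * n"] show "(fst u * fst v, snd u * snd v) \<in> S"
      by (simp add: g(2) h(2) algebra_simps mult_scaleC_left mult_scaleC_right scaleC_scaleC scaleC_add_right)
  qed
  moreover have "(f x, f y) \<in> closure S"
    using SI[OF f, of 0] closure_subset by auto
  ultimately have "(1, 0) \<in> closure S" using disj by (rule pair_disjoint_spectra)
  then obtain u where u: "u \<in> S" "dist u (1, 0) < 1/16"
    unfolding closure_approachable by (metis zero_less_divide_1_iff zero_less_numeral)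
  obtain g m where g: "g \<in> E" "u = (g x + m *\<^sub>C 1, g y + m *\<^sub>C 1)" using SE[OF u(1)] by blast
  have "norm (g x + m *\<^sub>C 1 - 1) \<le> 1/16" "norm (g y + m *\<^sub>C 1) \<le> 1/16"
    using dist_fst_le[of u "(1, 0)"] dist_snd_le[of u "(1, 0)"] u(2) by (auto simp: g(2) dist_norm)
  then have gx: "norm (g x - (1 - m) *\<^sub>C 1) \<le> 1/16" and gy: "norm (g y - (- m) *\<^sub>C 1) \<le> 1/16"
    by (simp_all add: scaleC_diff_left scaleC_minus_left scaleC_one algebra_simps)
  have "cmod (1 - m) \<ge> 1/2 \<or> cmod (- m) \<ge> 1/2"
    using norm_triangle_ineq[of "1 - m" m] by auto
  then show ?thesis
    using approx_sep_scalar_values[OF g(1) gx gy] approx_sep_scalar_values[OF g(1) gy gx] by auto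
qed

text \<open>A local unit at \<open>x\<close>, small off a compact set because \<open>h\<close>
  vanishes at infinity. It supplies the missing unit in \<open>approx_sep_flip\<close> and reduces
  closed sets to compact ones.\<close>

lemma nondegenerate_approx_sep:
  assumes "x \<notin> degenerate"
  shows "\<exists>U K. open U \<and> x \<in> U \<and> compact K \<and> approx_sep U (- K)"
proof -
  obtain h where h: "h \<in> E" "\<forall>t. st (h t) = h t" "norm (h x - 1) < 1"
    using nondegenerateE[OF assms] by blast
  define \<beta> where "\<beta> = (1 - norm (h x - 1)) / 2"
  have b: "\<beta> > 0" "norm (h x - 1) < 1 - \<beta>" using h(3) by (simp_all add: \<beta>_def field_simps)
  have sa: "st (h t) = h t" for t using h(2) by blast
  have "\<exists>g\<in>E. \<forall>x. (norm (h x - 1) \<le> 1 - \<beta> \<longrightarrow> norm (g x - 1) \<le> 1/4) \<and>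
      (norm (h x) \<le> \<beta>/2 \<longrightarrow> norm (g x) \<le> 1/4) \<and> norm (g x) \<le> 1 + 1/4"
    by (rule E_cutoff[OF h(1) sa]) (use b in auto)
  then obtain g where g: "g \<in> E" "\<forall>x. (norm (h x - 1) \<le> 1 - \<beta> \<longrightarrow> norm (g x - 1) \<le> 1/4) \<and>
      (norm (h x) \<le> \<beta>/2 \<longrightarrow> norm (g x) \<le> 1/4)" by blast
  show ?thesis
  proof (intro exI conjI)
    show "open {t. norm (h t - 1) < 1 - \<beta>}"
      by (intro open_Collect_less continuous_intros E_continuous[OF h(1)])
    show "x \<in> {t. norm (h t - 1) < 1 - \<beta>}" using b by simp
    show "compact {t. \<beta>/2 \<le> norm (h t)}" using b by (intro C0_compact E_C0 h) auto
    show "approx_sep {t. norm (h t - 1) < 1 - \<beta>} (- {t. \<beta>/2 \<le> norm (h t)})"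
      by (rule approx_sepI[OF g(1)]) (use g(2) in \<open>auto simp: not_le intro: less_imp_le\<close>)
  qed
qed

text \<open>Disjoint spectra may separate in the wrong direction; the local unit at \<open>x\<close>
  then reverses it.\<close>

lemma approx_sep_points:
  assumes x: "x \<notin> degenerate" and n: "\<not> eqv x y" shows "approx_sep {x} {y}"
proof -
  obtain f where "f \<in> E" "spec (f x) \<inter> spec (f y) = {}"
    using eqv_or_disjoint_spectra n by blast
  then consider "approx_sep {x} {y}" | "approx_sep {y} {x}"
    using disjoint_spectra_approx_sep by blast
  then show ?thesis
  proof cases
    case 2
    obtain U K where "x \<in> U" "approx_sep U (- K)" using nondegenerate_approx_sep[OF x] by blast
    then show ?thesis using approx_sep_mono[OF approx_sep_flip[OF 2]] by blast
  qed
qed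

text \<open>The local unit at \<open>x\<close> takes care of \<open>- K\<close>, so only the compact
  set \<open>V \<inter> K\<close> has to be covered, and the finitely many neighbourhoods of
  \<open>x\<close> are intersected.\<close>

lemma approx_sep_point_closed:
  assumes x: "x \<notin> degenerate" and V: "closed V" and n: "\<And>y. y \<in> V \<Longrightarrow> \<not> eqv x y"
  shows "\<exists>U. open U \<and> x \<in> U \<and> approx_sep U V"
proof -
  obtain U0 K where U0: "open U0" "x \<in> U0" "compact K" "approx_sep U0 (- K)"
    using nondegenerate_approx_sep[OF x] by blast
  have "\<forall>y\<in>V. \<exists>p. open (fst p) \<and> open (snd p) \<and> x \<in> fst p \<and> y \<in> snd p \<and> approx_sep (fst p) (snd p)"
  proof
    fix y assume "y \<in> V"
    from approx_sep_open[OF approx_sep_points[OF x n[OF this]]]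
    obtain U' V' where "open U'" "open V'" "{x} \<subseteq> U'" "{y} \<subseteq> V'" "approx_sep U' V'" by blast
    then show "\<exists>p. open (fst p) \<and> open (snd p) \<and> x \<in> fst p \<and> y \<in> snd p \<and> approx_sep (fst p) (snd p)"
      by (intro exI[of _ "(U', V')"]) simp
  qed
  from bchoice[OF this] obtain P where P: "\<forall>y\<in>V. open (fst (P y)) \<and> open (snd (P y)) \<and>
      x \<in> fst (P y) \<and> y \<in> snd (P y) \<and> approx_sep (fst (P y)) (snd (P y))" by blast
  define U where "U y = fst (P y)" for y
  define W where "W y = snd (P y)" for y
  have UW: "\<forall>y\<in>V. open (U y) \<and> open (W y) \<and> x \<in> U y \<and> y \<in> W y \<and> approx_sep (U y) (W y)"
    using P by (simp add: U_def W_def)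
  have "compact (V \<inter> K)" using V U0 by (intro closed_Int_compact)
  then obtain F where F: "F \<subseteq> V \<inter> K" "finite F" "V \<inter> K \<subseteq> (\<Union>y\<in>F. W y)"
    by (rule compactE_image[of _ "V \<inter> K" W]) (use UW in auto)
  have "\<exists>U'. open U' \<and> x \<in> U' \<and> approx_sep U' (- K \<union> (\<Union>y\<in>F. W y))"
    using F(2,1)
  proof (induction F rule: finite_induct)
    case empty
    then show ?case using U0 by auto
  next
    case (insert y F)
    have "F \<subseteq> V \<inter> K" using insert.prems by simp
    from insert.IH[OF this] obtain U' where
      U': "open U'" "x \<in> U'" "approx_sep U' (- K \<union> (\<Union>y\<in>F. W y))" by (elim exE conjE)
    have y: "open (U y)" "x \<in> U y" "approx_sep (U y) (W y)" using UW insert.prems by auto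
    have "approx_sep (U' \<inter> U y) (- K \<union> (\<Union>y\<in>insert y F. W y))"
      by (rule approx_sep_mono[OF approx_sep_Int[OF U'(3) y(3)]]) auto
    then show ?case using U' y by (intro exI[of _ "U' \<inter> U y"]) auto
  qed
  then obtain U' where U': "open U'" "x \<in> U'" "approx_sep U' (- K \<union> (\<Union>y\<in>F. W y))"
    by (elim exE conjE)
  have "approx_sep U' V" by (rule approx_sep_mono[OF U'(3)]) (use F(3) in auto)
  then show ?thesis using U' by blast
qed

lemma approx_sep_compact_closed:
  assumes F: "compact F" "F \<inter> degenerate = {}" and V: "closed V"
    and n: "\<And>x y. x \<in> F \<Longrightarrow> y \<in> V \<Longrightarrow> \<not> eqv x y"
  shows "approx_sep F V"
proof -
  have "\<forall>x\<in>F. \<exists>U. open U \<and> x \<in> U \<and> approx_sep U V"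
  proof
    fix x assume "x \<in> F"
    with F(2) have "x \<notin> degenerate" by blast
    from approx_sep_point_closed[OF this V n[OF \<open>x \<in> F\<close>]]
    show "\<exists>U. open U \<and> x \<in> U \<and> approx_sep U V" .
  qed
  from bchoice[OF this] obtain U where U: "\<forall>x\<in>F. open (U x) \<and> x \<in> U x \<and> approx_sep (U x) V" by blast
  obtain G where G: "G \<subseteq> F" "finite G" "F \<subseteq> (\<Union>x\<in>G. U x)"
    by (rule compactE_image[OF F(1), of F U]) (use U in auto)
  have "approx_sep (\<Union>x\<in>G. U x) V"
    using G(2,1)
  proof (induction G rule: finite_induct)
    case empty
    then show ?case by (simp add: approx_sep_empty)
  next
    case (insert x G)
    then show ?case using U approx_sep_Un[of "U x" V "\<Union>x\<in>G. U x"] by auto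
  qed
  then show ?thesis using approx_sep_mono G(3) by blast
qed

end

section \<open>Scalar functions and gluing\<close>

text \<open>Cuts \<open>t\<close> into unit layers; for \<open>t = n * \<theta> x\<close> these are
  the targets of the \<open>n\<close> elements averaged in
  \<open>scalar_function_approx\<close>.\<close>

lemma sum_clamp:
  fixes t :: real
  assumes "0 \<le> t" "t \<le> real n"
  shows "(\<Sum>k<n. max 0 (min 1 (t - real k))) = t"
  using assms
proof (induction n arbitrary: t)
  case (Suc n)
  show ?case
  proof (cases "t \<le> real n")
    case True
    then show ?thesis using Suc by simp
  next
    case False
    have "(\<Sum>k<n. max 0 (min 1 (t - real k))) = (\<Sum>k<n. 1)"
      using False by (intro sum.cong) (auto simp: max_def min_def)
    then show ?thesis using False Suc.prems by (simp add: max_def min_def)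
  qed
qed simp

text \<open>Only \<open>k = \<lfloor>t\<rfloor>\<close> can satisfy both strict inequalities, so at
  most one summand differs from \<open>0\<close>.\<close>

lemma sum_unit_gap_le:
  fixes t :: real
  shows "(\<Sum>k<n. if real k < t \<and> t < real k + 1 then c else 0) \<le> max 0 (c::real)"
proof -
  define C where "C = {k \<in> {..<n}. real k < t \<and> t < real k + 1}"
  have "C \<subseteq> {nat \<lfloor>t\<rfloor>}"
  proof
    fix k assume "k \<in> C"
    then have "\<lfloor>t\<rfloor> = int k" by (simp add: C_def floor_eq_iff)
    then show "k \<in> {nat \<lfloor>t\<rfloor>}" by simp
  qed
  then have "card C \<le> card {nat \<lfloor>t\<rfloor>}" by (intro card_mono) auto
  then have "card C = 0 \<or> card C = 1" by (simp add: le_Suc_eq del: card_eq_0_iff)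
  moreover have "(\<Sum>k<n. if real k < t \<and> t < real k + 1 then c else 0) = (\<Sum>k\<in>C. c)"
    unfolding C_def by (rule sum.inter_filter[symmetric]) simp
  ultimately show ?thesis by auto
qed

section \<open>Central scalar functions as a partition of unity\<close>

context spectral_function_algebra
begin

text \<open>Averaging elements that are near \<open>1\<close> on \<open>{\<theta> \<ge> (k+1)/n}\<close> and near \<open>0\<close> on \<open>{\<theta> \<le> k/n}\<close>: at every
  point at most one of the \<open>n\<close> summands is uncontrolled, whatever the lack of commutativity.\<close>

lemma scalar_function_approx:
  fixes \<theta> :: "'x \<Rightarrow> real"
  assumes cont: "continuous_on UNIV \<theta>" and range: "\<And>x. 0 \<le> \<theta> x" "\<And>x. \<theta> x \<le> 1"
    and sat: "\<And>x y. eqv x y \<Longrightarrow> \<theta> x = \<theta> y"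
    and cpt: "\<And>a. a > 0 \<Longrightarrow> compact {x. a \<le> \<theta> x}"
    and deg: "\<And>x. x \<in> degenerate \<Longrightarrow> \<theta> x = 0" and d: "\<delta> > 0"
  shows "\<exists>H\<in>E. \<forall>x. norm (H x - \<theta> x *\<^sub>R 1) \<le> \<delta>"
proof -
  \<comment> \<open>Gives \<open>4 / n \<le> \<delta> / 2\<close>, where \<open>4\<close> bounds the
    one uncontrolled summand.\<close>
  obtain m where m: "1 / real (Suc m) < \<delta> / 8" using nat_approx_posE[of "\<delta>/8"] d by auto
  define n where "n = Suc m"
  have n: "n > 0" "4 / real n \<le> \<delta> / 2" using m by (auto simp: n_def field_simps)
  define \<eta> where "\<eta> = min 1 (\<delta> / 2)"
  have \<eta>: "\<eta> > 0" "\<eta> \<le> 1" "\<eta> \<le> \<delta> / 2" using d by (auto simp: \<eta>_def)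
  have "\<exists>h\<in>E. (\<forall>x\<in>{x. real (Suc k) / n \<le> \<theta> x}. norm (h x - 1) \<le> \<eta>) \<and>
      (\<forall>x\<in>{x. \<theta> x \<le> real k / n}. norm (h x) \<le> \<eta>) \<and> (\<forall>x. norm (h x) \<le> 1 + \<eta>)" for k
  proof (rule approx_sep_sharpen[OF approx_sep_compact_closed \<eta>(1)])
    show "compact {x. real (Suc k) / n \<le> \<theta> x}" using n by (intro cpt) auto
    have "real (Suc k) / n > 0" using n by simp
    then show "{x. real (Suc k) / n \<le> \<theta> x} \<inter> degenerate = {}" using deg by fastforce
    show "closed {x. \<theta> x \<le> real k / n}" by (intro closed_Collect_le cont continuous_intros)
    fix x y assume "x \<in> {x. real (Suc k) / n \<le> \<theta> x}" "y \<in> {x. \<theta> x \<le> real k / n}"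
    moreover have "real k / n < real (Suc k) / n" using n by (simp add: divide_strict_right_mono)
    ultimately have "\<theta> x \<noteq> \<theta> y" by auto
    then show "\<not> eqv x y" using sat by blast
  qed
  then have "\<forall>k. \<exists>h. h \<in> E \<and> (\<forall>x. real (Suc k) / n \<le> \<theta> x \<longrightarrow> norm (h x - 1) \<le> \<eta>) \<and>
      (\<forall>x. \<theta> x \<le> real k / n \<longrightarrow> norm (h x) \<le> \<eta>) \<and> (\<forall>x. norm (h x) \<le> 1 + \<eta>)"
    by blast
  from choice[OF this] obtain h where hh: "\<forall>k. h k \<in> E \<and> (\<forall>x. real (Suc k) / n \<le> \<theta> x \<longrightarrow> norm (h k x - 1) \<le> \<eta>) \<and>
      (\<forall>x. \<theta> x \<le> real k / n \<longrightarrow> norm (h k x) \<le> \<eta>) \<and> (\<forall>x. norm (h k x) \<le> 1 + \<eta>)"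
    by (elim exE)
  have hE: "h k \<in> E" for k using hh by simp
  have h1: "norm (h k x - 1) \<le> \<eta>" if "real (Suc k) / n \<le> \<theta> x" for k x using hh that by simp
  have h0: "norm (h k x) \<le> \<eta>" if "\<theta> x \<le> real k / n" for k x using hh that by simp
  have hb: "norm (h k x) \<le> 2" for k x
    using hh \<eta>(2) order_trans[of "norm (h k x)" "1 + \<eta>" 2] by simp
  define H where "H x = (1 / real n) *\<^sub>R (\<Sum>k<n. h k x)" for x
  have HE: "H \<in> E" unfolding H_def by (intro E_scaleR E_sum hE)
  have "norm (H x - \<theta> x *\<^sub>R 1) \<le> \<delta>" for x
  proof -
    define t where "t = real n * \<theta> x"
    define w where "w k = max 0 (min 1 (t - real k))" for k
    have t: "0 \<le> t" "t \<le> real n"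
      using range[of x] n(1) mult_left_mono[OF range(2)[of x], of "real n"] by (auto simp: t_def)
    have "\<theta> x *\<^sub>R 1 = (1 / real n) *\<^sub>R (\<Sum>k<n. w k *\<^sub>R (1::'a))"
      unfolding w_def using sum_clamp[OF t] n(1) by (simp add: t_def flip: scaleR_sum_left)
    then have "H x - \<theta> x *\<^sub>R 1 = (1 / real n) *\<^sub>R (\<Sum>k<n. h k x - w k *\<^sub>R 1)"
      by (simp add: H_def sum_subtractf scaleR_diff_right)
    then have "norm (H x - \<theta> x *\<^sub>R 1) = (1 / real n) * norm (\<Sum>k<n. h k x - w k *\<^sub>R 1)" by simp
    also have "\<dots> \<le> (1 / real n) * (\<Sum>k<n. \<eta> + (if real k < t \<and> t < real k + 1 then 4 else 0))"
    proof (intro mult_left_mono sum_norm_le)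
      fix k
      consider "t \<le> real k" | "real k + 1 \<le> t" | "real k < t" "t < real k + 1" by linarith
      then show "norm (h k x - w k *\<^sub>R 1) \<le> \<eta> + (if real k < t \<and> t < real k + 1 then 4 else 0)"
      proof cases
        case 1
        then have "w k = 0" "\<theta> x \<le> real k / n" using n(1) by (auto simp: w_def t_def field_simps)
        then show ?thesis using h0[of x k] by simp
      next
        case 2
        then have "w k = 1" "real (Suc k) / n \<le> \<theta> x" using n(1) by (auto simp: w_def t_def field_simps)
        then show ?thesis using h1[of k x] by simp
      next
        case 3
        have "norm (h k x - w k *\<^sub>R 1) \<le> norm (h k x) + norm (w k *\<^sub>R (1::'a))"
          by (rule norm_triangle_ineq4)
        also have "\<dots> \<le> 2 + 1" using hb[of k x] by (intro add_mono) (auto simp: w_def)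
        finally show ?thesis using 3 \<eta>(1) by simp
      qed
    qed simp
    also have "\<dots> = (1 / real n) * (real n * \<eta> + (\<Sum>k<n. if real k < t \<and> t < real k + 1 then 4 else 0))"
      by (simp add: sum.distrib)
    also have "\<dots> \<le> (1 / real n) * (real n * \<eta> + 4)"
      using sum_unit_gap_le[of t 4 n] by (intro mult_left_mono add_left_mono) auto
    also have "\<dots> = \<eta> + 4 / real n" using n(1) by (simp add: field_simps)
    also have "\<dots> \<le> \<delta>" using \<eta>(3) n(2) by simp
    finally show ?thesis .
  qed
  then show ?thesis using HE by blast
qed

text \<open>A single \<open>w\<close> in \<open>E\<close> approximates \<open>u\<close> at both
  points, and \<open>v - w\<close> in \<open>E\<close> has the same norm at both; approximation at
  pairs of points enters here.\<close>

lemma Delta2_norm_diff_eqv: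
  assumes u: "u \<in> Delta2 E" and v: "v \<in> E" and xy: "eqv x y"
  shows "norm (v x - u x) = norm (v y - u y)"
proof -
  have le: "norm (v x - u x) \<le> norm (v y - u y)" if xy: "eqv x y" for x y
  proof (rule field_le_epsilon)
    fix e :: real assume e: "e > 0"
    then have "e / 2 > 0" by simp
    then obtain w where w: "w \<in> E" "norm (w x - u x) < e/2" "norm (w y - u y) < e/2"
      using u unfolding Delta2_def by blast
    have "norm (v x - w x) = norm (v y - w y)"
      using xy E_diff[OF v w(1)] by (auto simp: eqv_def)
    moreover have "norm (v x - u x) \<le> norm (v x - w x) + norm (w x - u x)"
      using norm_triangle_ineq[of "v x - w x" "w x - u x"] by simp
    moreover have "norm (v y - w y) \<le> norm (v y - u y) + norm (w y - u y)"
      using norm_triangle_ineq4[of "v y - u y" "w y - u y"] by simp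
    ultimately show "norm (v x - u x) \<le> norm (v y - u y) + e" using w by linarith
  qed
  show ?thesis using le[OF xy] le[OF eqv_sym[OF xy]] by simp
qed

lemma Delta2_diff:
  assumes u: "u \<in> Delta2 E" and v: "v \<in> E" shows "(\<lambda>x. u x - v x) \<in> Delta2 E"
  unfolding Delta2_def
proof (intro CollectI conjI allI impI)
  show "(\<lambda>x. u x - v x) \<in> C0" using u by (intro C0_diff[OF _ E_C0[OF v]]) (simp add: Delta2_def)
  fix x y and e :: real assume "e > 0"
  then obtain w where w: "w \<in> E" "norm (w x - u x) < e" "norm (w y - u y) < e"
    using u unfolding Delta2_def by blast
  then show "\<exists>w\<in>E. norm (w x - (u x - v x)) < e \<and> norm (w y - (u y - v y)) < e"
    by (intro bexI[of _ "\<lambda>t. w t - v t"] E_diff v) auto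
qed

text \<open>A function of \<open>norm (h t)\<close> alone is constant on equivalence classes. The
  ramp rises between \<open>1/4\<close> and \<open>3/4\<close>, while the norm is at most
  \<open>1/16\<close> on \<open>V\<close> and at least \<open>15/16\<close> on \<open>U\<close>; the
  superlevel sets are compact because \<open>\<theta> t > 0\<close> forces
  \<open>norm (h t) > 1/4\<close>.\<close>

lemma bump_function:
  assumes x: "x \<notin> degenerate" and V: "closed V" and n: "\<forall>y\<in>V. \<not> eqv x y"
  shows "\<exists>U \<theta>. open U \<and> x \<in> U \<and> continuous_on UNIV \<theta> \<and> (\<forall>t. 0 \<le> \<theta> t \<and> \<theta> t \<le> (1::real)) \<and>
    (\<forall>s t. eqv s t \<longrightarrow> \<theta> s = \<theta> t) \<and> (\<forall>a>0. compact {t. a \<le> \<theta> t}) \<and>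
    (\<forall>t\<in>U. \<theta> t = 1) \<and> (\<forall>t\<in>V. \<theta> t = 0)"
proof -
  have "\<exists>U. open U \<and> x \<in> U \<and> approx_sep U V"
    by (rule approx_sep_point_closed[OF x V]) (use n in blast)
  then obtain U where U: "open U" "x \<in> U" "approx_sep U V" by (elim exE conjE)
  obtain h where h: "h \<in> E" "\<forall>x\<in>U. norm (h x - 1) \<le> 1/16" "\<forall>x\<in>V. norm (h x) \<le> 1/16"
    "\<forall>x. norm (h x) \<le> 1 + 1/16"
    by (rule approx_sepE[OF U(3)])
  define \<theta> where "\<theta> t = max 0 (min 1 ((norm (h t) - 1/4) / (1/2)))" for t
  have "continuous_on UNIV \<theta>" unfolding \<theta>_def
    by (intro continuous_intros E_continuous[OF h(1)]) auto
  moreover have "\<forall>t. 0 \<le> \<theta> t \<and> \<theta> t \<le> 1" by (auto simp: \<theta>_def)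
  moreover have "\<forall>s t. eqv s t \<longrightarrow> \<theta> s = \<theta> t" using h(1) by (auto simp: \<theta>_def eqv_def)
  moreover have "compact {t. a \<le> \<theta> t}" if a: "a > 0" for a
  proof -
    have "compact {t. 1/4 \<le> norm (h t)}" by (intro C0_compact E_C0 h) auto
    moreover have "closed {t. a \<le> \<theta> t}" by (intro closed_Collect_le continuous_intros calculation(1)) fact
    ultimately have "compact ({t. a \<le> \<theta> t} \<inter> {t. 1/4 \<le> norm (h t)})" by (intro closed_Int_compact)
    moreover have "{t. a \<le> \<theta> t} \<inter> {t. 1/4 \<le> norm (h t)} = {t. a \<le> \<theta> t}"
      using a by (auto simp: \<theta>_def)
    ultimately show ?thesis by simp
  qed
  moreover have "\<theta> t = 1" if "t \<in> U" for t
  proof -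
    have "norm (h t - 1) \<le> 1/16" using h(2) that by blast
    moreover have "norm (1::'a) \<le> norm (h t) + norm (h t - 1)"
      using norm_triangle_ineq4[of "h t" "h t - 1"] by simp
    ultimately show ?thesis by (simp add: \<theta>_def)
  qed
  moreover have "\<theta> t = 0" if "t \<in> V" for t
  proof -
    have "norm (h t) \<le> 1/16" using h(3) that by blast
    then show ?thesis by (simp add: \<theta>_def)
  qed
  ultimately show ?thesis using U(1,2) by (intro exI[of _ U] exI[of _ \<theta>]) simp
qed

text \<open>Each point where \<open>u\<close> is not small gets a local approximation
  \<open>v\<close> and a bump vanishing wherever \<open>v\<close> is far from \<open>u\<close>. Such
  a bump exists because the closed set where \<open>v\<close> is far misses the whole class of the
  point, by \<open>Delta2_norm_diff_eqv\<close>.\<close>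

lemma Delta2_approx_off_degenerate:
  assumes u: "u \<in> Delta2 E" and e: "e > 0" and deg: "\<And>x. x \<in> degenerate \<Longrightarrow> norm (u x) < e"
  shows "\<exists>w\<in>E. \<forall>x. norm (w x - u x) \<le> 2 * e"
proof -
  have uC0: "u \<in> C0" using u by (simp add: Delta2_def)
  define F where "F = {x. e \<le> norm (u x)}"
  have F: "compact F" unfolding F_def by (rule C0_compact[OF uC0 e])
  \<comment> \<open>The triple \<open>p\<close> bundles the neighbourhood, the bump and the local
    approximation for a single use of choice.\<close>
  have "\<forall>x\<in>F. \<exists>p. open (fst p) \<and> x \<in> fst p \<and> snd (snd p) \<in> E \<and> continuous_on UNIV (fst (snd p)) \<and>
      (\<forall>t. 0 \<le> fst (snd p) t \<and> fst (snd p) t \<le> (1::real)) \<and>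
      (\<forall>s t. eqv s t \<longrightarrow> fst (snd p) s = fst (snd p) t) \<and> (\<forall>a>0. compact {t. a \<le> fst (snd p) t}) \<and>
      (\<forall>t\<in>fst p. fst (snd p) t = 1) \<and>
      (\<forall>t. t \<in> degenerate \<or> e \<le> norm (snd (snd p) t - u t) \<longrightarrow> fst (snd p) t = 0)"
  proof
    fix x assume xF: "x \<in> F"
    obtain v where v: "v \<in> E" "norm (v x - u x) < e" using u e unfolding Delta2_def by blast
    have x: "x \<notin> degenerate" using deg[of x] xF by (auto simp: F_def)
    define V where "V = degenerate \<union> {t. e \<le> norm (v t - u t)}"
    have "closed {t. e \<le> norm (v t - u t)}"
      by (intro closed_Collect_le continuous_intros E_continuous[OF v(1)] C0_D(1)[OF uC0])
    then have V: "closed V" unfolding V_def by (intro closed_Un closed_degenerate)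
    have neq: "\<forall>y\<in>V. \<not> eqv x y"
    proof (intro ballI notI)
      fix y assume yV: "y \<in> V" and xy: "eqv x y"
      then have "y \<notin> degenerate" using x by (simp add: eqv_def)
      then show False using yV Delta2_norm_diff_eqv[OF u v(1) xy] v(2) by (simp add: V_def)
    qed
    from bump_function[OF x V neq] obtain U \<theta> where U\<theta>: "open U" "x \<in> U" "continuous_on UNIV \<theta>"
      "\<forall>t. 0 \<le> \<theta> t \<and> \<theta> t \<le> (1::real)" "\<forall>s t. eqv s t \<longrightarrow> \<theta> s = \<theta> t"
      "\<forall>a>0. compact {t. a \<le> \<theta> t}" "\<forall>t\<in>U. \<theta> t = 1" "\<forall>t\<in>V. \<theta> t = 0"
      by (elim exE conjE)
    show "\<exists>p. open (fst p) \<and> x \<in> fst p \<and> snd (snd p) \<in> E \<and> continuous_on UNIV (fst (snd p)) \<and>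
      (\<forall>t. 0 \<le> fst (snd p) t \<and> fst (snd p) t \<le> (1::real)) \<and>
      (\<forall>s t. eqv s t \<longrightarrow> fst (snd p) s = fst (snd p) t) \<and> (\<forall>a>0. compact {t. a \<le> fst (snd p) t}) \<and>
      (\<forall>t\<in>fst p. fst (snd p) t = 1) \<and>
      (\<forall>t. t \<in> degenerate \<or> e \<le> norm (snd (snd p) t - u t) \<longrightarrow> fst (snd p) t = 0)"
      by (rule exI[of _ "(U, \<theta>, v)"]) (use U\<theta> v in \<open>simp add: V_def\<close>)
  qed
  from bchoice[OF this] obtain P where P: "\<forall>x\<in>F. open (fst (P x)) \<and> x \<in> fst (P x) \<and>
      snd (snd (P x)) \<in> E \<and> continuous_on UNIV (fst (snd (P x))) \<and>
      (\<forall>t. 0 \<le> fst (snd (P x)) t \<and> fst (snd (P x)) t \<le> (1::real)) \<and>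
      (\<forall>s t. eqv s t \<longrightarrow> fst (snd (P x)) s = fst (snd (P x)) t) \<and>
      (\<forall>a>0. compact {t. a \<le> fst (snd (P x)) t}) \<and>
      (\<forall>t\<in>fst (P x). fst (snd (P x)) t = 1) \<and>
      (\<forall>t. t \<in> degenerate \<or> e \<le> norm (snd (snd (P x)) t - u t) \<longrightarrow> fst (snd (P x)) t = 0)"
    by (elim exE)
  define U \<theta> v where "U x = fst (P x)" and "\<theta> x = fst (snd (P x))" and "v x = snd (snd (P x))" for x
  note defs = U_def[symmetric] \<theta>_def[symmetric] v_def[symmetric]
  note P' = P[unfolded defs]
  obtain G where G: "G \<subseteq> F" "finite G" "F \<subseteq> (\<Union>x\<in>G. U x)"
    by (rule compactE_image[OF F, of F U]) (use P' in auto)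
  have vE: "v i \<in> E" and th_cont: "continuous_on UNIV (\<theta> i)" and th_ge: "0 \<le> \<theta> i t" and th_le: "\<theta> i t \<le> 1"
    and th_cpt: "a > 0 \<Longrightarrow> compact {t. a \<le> \<theta> i t}"
    and th_sat: "eqv s t \<Longrightarrow> \<theta> i s = \<theta> i t" and th_one: "t \<in> U i \<Longrightarrow> \<theta> i t = 1"
    and th_deg: "t \<in> degenerate \<Longrightarrow> \<theta> i t = 0"
    and th_far: "e \<le> norm (v i t - u t) \<Longrightarrow> \<theta> i t = 0"
    if "i \<in> G" for i s t a
    using bspec[OF P', of i] that G(1) by auto
  \<comment> \<open>The sum of the bumps is at least \<open>1\<close> on \<open>F\<close>, so
    dividing by this maximum gives weights with sum exactly \<open>1\<close> there and at most
    \<open>1\<close> elsewhere, and the divisor never vanishes.\<close>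
  define N where "N t = max 1 (\<Sum>i\<in>G. \<theta> i t)" for t
  define \<phi> where "\<phi> i t = \<theta> i t / N t" for i t
  have N1: "N t \<ge> 1" for t by (simp add: N_def)
  have N_cont: "continuous_on UNIV N"
    unfolding N_def by (intro continuous_intros th_cont)
  have ph_le: "\<phi> i t \<le> \<theta> i t" if "i \<in> G" for i t
    using N1[of t] th_ge[OF that, of t] mult_left_mono[of 1 "N t" "\<theta> i t"]
    by (simp add: \<phi>_def pos_divide_le_eq)
  have ph_ge: "0 \<le> \<phi> i t" if "i \<in> G" for i t
    using N1[of t] th_ge[OF that, of t] by (simp add: \<phi>_def)
  have ph_cont: "continuous_on UNIV (\<phi> i)" if "i \<in> G" for i
  proof -
    have "N t \<noteq> 0" for t using N1[of t] by auto
    then show ?thesis unfolding \<phi>_def using th_cont[OF that] N_cont by (intro continuous_intros) auto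
  qed
  have ph_sum: "(\<Sum>i\<in>G. \<phi> i t) \<le> 1" "t \<in> F \<Longrightarrow> (\<Sum>i\<in>G. \<phi> i t) = 1" for t
  proof -
    have s: "(\<Sum>i\<in>G. \<phi> i t) = (\<Sum>i\<in>G. \<theta> i t) / N t" by (simp add: \<phi>_def sum_divide_distrib)
    have "(\<Sum>i\<in>G. \<theta> i t) \<le> N t" by (simp add: N_def)
    then show "(\<Sum>i\<in>G. \<phi> i t) \<le> 1" unfolding s using N1[of t] by (simp add: divide_le_eq_1)
    assume "t \<in> F"
    then obtain i where i: "i \<in> G" "t \<in> U i" using G(3) by auto
    then have "1 \<le> (\<Sum>i\<in>G. \<theta> i t)"
      using member_le_sum[OF i(1), of "\<lambda>i. \<theta> i t"] th_ge G(2) th_one[OF i] by simp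
    then show "(\<Sum>i\<in>G. \<phi> i t) = 1" unfolding s by (simp add: N_def)
  qed
  have "\<forall>i\<in>G. \<exists>B>0. \<forall>t. norm (v i t) \<le> B" using C0_bounded E_C0 vE by blast
  from bchoice[OF this] obtain B where B: "\<forall>i\<in>G. B i > 0 \<and> (\<forall>t. norm (v i t) \<le> B i)" by (elim exE)
  \<comment> \<open>So small that replacing all the \<open>\<phi> i\<close> by the
    \<open>H i\<close> costs at most \<open>e\<close> in total.\<close>
  define \<delta> where "\<delta> = e / ((\<Sum>i\<in>G. B i) + 1)"
  have Bs: "(\<Sum>i\<in>G. B i) \<ge> 0" using B by (intro sum_nonneg) (auto intro: less_imp_le)
  have d: "\<delta> > 0" using Bs e by (simp add: \<delta>_def)
  have "\<forall>i\<in>G. \<exists>H. H \<in> E \<and> (\<forall>t. norm (H t - \<phi> i t *\<^sub>R 1) \<le> \<delta>)"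
  proof
    fix i assume i: "i \<in> G"
    have "\<exists>H\<in>E. \<forall>t. norm (H t - \<phi> i t *\<^sub>R 1) \<le> \<delta>"
    proof (rule scalar_function_approx[OF ph_cont[OF i] ph_ge[OF i] _ _ _ _ d])
      show "\<phi> i t \<le> 1" for t using ph_le[OF i, of t] th_le[OF i, of t] by simp
      show "\<phi> i s = \<phi> i t" if "eqv s t" for s t
      proof -
        have "(\<Sum>j\<in>G. \<theta> j s) = (\<Sum>j\<in>G. \<theta> j t)" by (intro sum.cong refl th_sat[OF _ that])
        then show ?thesis using th_sat[OF i that] by (simp add: \<phi>_def N_def)
      qed
      show "compact {t. a \<le> \<phi> i t}" if a: "a > 0" for a
      proof -
        have "closed {t. a \<le> \<phi> i t}" by (intro closed_Collect_le continuous_intros ph_cont[OF i])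
        then have "compact ({t. a \<le> \<phi> i t} \<inter> {t. a \<le> \<theta> i t})"
          by (intro closed_Int_compact th_cpt[OF i a])
        moreover have "{t. a \<le> \<phi> i t} \<inter> {t. a \<le> \<theta> i t} = {t. a \<le> \<phi> i t}"
          using order_trans[OF _ ph_le[OF i]] by auto
        ultimately show ?thesis by simp
      qed
      show "\<phi> i t = 0" if "t \<in> degenerate" for t using th_deg[OF i that] by (simp add: \<phi>_def)
    qed
    then show "\<exists>H. H \<in> E \<and> (\<forall>t. norm (H t - \<phi> i t *\<^sub>R 1) \<le> \<delta>)" by blast
  qed
  from bchoice[OF this] obtain H where H: "\<forall>i\<in>G. H i \<in> E \<and> (\<forall>t. norm (H i t - \<phi> i t *\<^sub>R 1) \<le> \<delta>)"
    by (elim exE)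
  define w where "w t = (\<Sum>i\<in>G. H i t * v i t)" for t
  have wE: "w \<in> E" unfolding w_def by (intro E_sum E_mult vE) (use H in auto)
  have "norm (w t - u t) \<le> 2 * e" for t
  proof -
    define \<sigma> where "\<sigma> = (\<Sum>i\<in>G. \<phi> i t)"
    \<comment> \<open>Three errors: replacing \<open>\<phi> i\<close> by \<open>H i\<close> costs at
      most \<open>e\<close>, the weighted distances at most \<open>\<sigma> * e\<close>, and the
      missing weight at most \<open>(1 - \<sigma>) * e\<close>, since weight is missing only off
      \<open>F\<close>, where \<open>u\<close> is smaller than \<open>e\<close>.\<close>
    have "w t - u t = (\<Sum>i\<in>G. (H i t - \<phi> i t *\<^sub>R 1) * v i t) +
        ((\<Sum>i\<in>G. \<phi> i t *\<^sub>R (v i t - u t)) - (1 - \<sigma>) *\<^sub>R u t)"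
      by (simp add: w_def \<sigma>_def algebra_simps sum_subtractf sum.distrib scaleR_sum_left)
    then have "norm (w t - u t) \<le> norm (\<Sum>i\<in>G. (H i t - \<phi> i t *\<^sub>R 1) * v i t) +
        (norm (\<Sum>i\<in>G. \<phi> i t *\<^sub>R (v i t - u t)) + norm ((1 - \<sigma>) *\<^sub>R u t))"
      by (simp only:) (rule order_trans[OF norm_triangle_ineq add_left_mono[OF norm_triangle_ineq4]])
    moreover have "norm (\<Sum>i\<in>G. (H i t - \<phi> i t *\<^sub>R 1) * v i t) \<le> (\<Sum>i\<in>G. \<delta> * B i)"
    proof (rule sum_norm_le)
      fix i assume i: "i \<in> G"
      have "norm ((H i t - \<phi> i t *\<^sub>R 1) * v i t) \<le> norm (H i t - \<phi> i t *\<^sub>R 1) * norm (v i t)"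
        by (rule norm_mult_ineq)
      also have "\<dots> \<le> \<delta> * B i" using H B i d by (intro mult_mono) auto
      finally show "norm ((H i t - \<phi> i t *\<^sub>R 1) * v i t) \<le> \<delta> * B i" .
    qed
    moreover have "(\<Sum>i\<in>G. \<delta> * B i) = e * ((\<Sum>i\<in>G. B i) / ((\<Sum>i\<in>G. B i) + 1))"
      by (subst sum_distrib_left[symmetric]) (simp add: \<delta>_def)
    moreover have "e * ((\<Sum>i\<in>G. B i) / ((\<Sum>i\<in>G. B i) + 1)) \<le> e" using e Bs by (intro mult_left_le) (auto simp: divide_le_eq_1)
    moreover have "norm (\<Sum>i\<in>G. \<phi> i t *\<^sub>R (v i t - u t)) \<le> (\<Sum>i\<in>G. \<phi> i t * e)"
    proof (rule sum_norm_le)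
      fix i assume i: "i \<in> G"
      show "norm (\<phi> i t *\<^sub>R (v i t - u t)) \<le> \<phi> i t * e"
      proof (cases "e \<le> norm (v i t - u t)")
        case True
        then show ?thesis using th_far[OF i True] by (simp add: \<phi>_def)
      next
        case False
        then show ?thesis using ph_ge[OF i, of t] by (simp add: mult_left_mono)
      qed
    qed
    moreover have "(\<Sum>i\<in>G. \<phi> i t * e) = \<sigma> * e" by (simp add: \<sigma>_def sum_distrib_right)
    moreover have "norm ((1 - \<sigma>) *\<^sub>R u t) \<le> (1 - \<sigma>) * e"
    proof (cases "t \<in> F")
      case True
      then show ?thesis using ph_sum(2)[OF True] by (simp add: \<sigma>_def)
    next
      case False
      then show ?thesis using ph_sum(1)[of t] by (simp add: \<sigma>_def F_def mult_left_mono)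
    qed
    moreover have "\<sigma> * e + (1 - \<sigma>) * e = e" by (simp add: algebra_simps)
    ultimately show ?thesis by linarith
  qed
  then show ?thesis using wE by blast
qed

end

section \<open>Both inclusions, and the correction at degenerate points\<close>

theorem theorem2p2:
  fixes st :: "'a::complex_banach_algebra_1 \<Rightarrow> 'a"
    and E :: "('x::t2_space \<Rightarrow> 'a) set"
  assumes "locally_compact_space (euclidean :: 'x topology)"
    and "cstar_involution st"
    and "star_subalgebra st E"
    and AX0: "\<not> compact (UNIV :: 'x set) \<Longrightarrow>
              \<forall>z. (\<exists>f0\<in>E. invertible_el (f0 z)) \<or> (\<forall>f\<in>E. f z = 0)"
    and AX12: "\<forall>x y. spectrally_separates st E x y \<or>
              (\<forall>f\<in>E. (\<forall>t. st (f t) = f t) \<longrightarrow> Mspec (f x) = Mspec (f y))"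
  shows "uniform_closure E = Delta2 E"
proof -
  interpret spectral_function_algebra st E
    using assms(2,3) AX12 by unfold_locales auto
  show ?thesis
  proof
    show "uniform_closure E \<subseteq> Delta2 E"
    proof
      fix u assume u: "u \<in> uniform_closure E"
      then have uC0: "u \<in> C0" by (simp add: uniform_closure_def)
      show "u \<in> Delta2 E" unfolding Delta2_def
      proof (intro CollectI conjI uC0 allI impI)
        fix x y :: 'x and e :: real assume "e > 0"
        then obtain v where v: "v \<in> E" "(SUP x. norm (v x - u x)) < e"
          using u unfolding uniform_closure_def by blast
        \<comment> \<open>Boundedness comes before the supremum can be used: over an unbounded set a
          real supremum carries no information.\<close>
        obtain B where "\<forall>x. norm (v x - u x) \<le> B"
          using C0_bounded[OF C0_diff[OF E_C0[OF v(1)] uC0]] by blast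
        then have "bdd_above (range (\<lambda>x. norm (v x - u x)))" by (intro bdd_aboveI2[of _ _ B]) auto
        then have "norm (v z - u z) \<le> (SUP x. norm (v x - u x))" for z by (intro cSUP_upper) auto
        then have "norm (v z - u z) < e" for z using v(2) le_less_trans by blast
        then show "\<exists>v\<in>E. norm (v x - u x) < e \<and> norm (v y - u y) < e" using v(1) by blast
      qed
    qed
    show "Delta2 E \<subseteq> uniform_closure E"
    proof
      fix u assume u: "u \<in> Delta2 E"
      then have uC0: "u \<in> C0" by (simp add: Delta2_def)
      show "u \<in> uniform_closure E" unfolding uniform_closure_def
      proof (intro CollectI conjI uC0 allI impI)
        fix e :: real assume e: "e > 0"
        \<comment> \<open>The gluing loses a factor \<open>2\<close>, and
          \<open>2 * d = e / 2\<close> keeps the final inequality strict.\<close>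
        define d where "d = e / 4"
        have d: "d > 0" using e by (simp add: d_def)
        \<comment> \<open>If there are degenerate points and the space is not compact, all of
          \<open>E\<close> vanishes at them, so \<open>u\<close> is arbitrarily small there and
          \<open>v0 = 0\<close> serves. In the compact case an approximation at one degenerate point
          is equally good at all of them.\<close>
        have "\<exists>v0\<in>E. \<forall>x\<in>degenerate. norm (u x - v0 x) < d"
        proof (cases "degenerate = {} \<or> \<not> compact (UNIV :: 'x set)")
          case True
          have "norm (u x - 0) < d" if x: "x \<in> degenerate" for x
          proof -
            have zero: "\<forall>f\<in>E. f x = 0" using AX0 True x by (auto simp: degenerate_def)
            obtain v where v: "v \<in> E" "norm (v x - u x) < d" using u d unfolding Delta2_def by blast
            then show ?thesis using bspec[OF zero v(1)] by simp
          qed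
          then show ?thesis by (intro bexI[OF _ E_zero]) blast
        next
          case False
          then obtain z where z: "z \<in> degenerate" by blast
          obtain v where v: "v \<in> E" "norm (v z - u z) < d" using u d unfolding Delta2_def by blast
          have "norm (u x - v x) < d" if "x \<in> degenerate" for x
            using Delta2_norm_diff_eqv[OF u v(1) degenerate_eqv[OF z that]] v(2)
            by (simp add: norm_minus_commute)
          then show ?thesis using v(1) by blast
        qed
        then obtain v0 where v0: "v0 \<in> E" "\<forall>x\<in>degenerate. norm (u x - v0 x) < d" by blast
        have "\<exists>w\<in>E. \<forall>x. norm (w x - (u x - v0 x)) \<le> 2 * d"
          by (rule Delta2_approx_off_degenerate[OF Delta2_diff[OF u v0(1)] d]) (use v0(2) in blast)
        then obtain w where w: "w \<in> E" "\<forall>x. norm (w x - (u x - v0 x)) \<le> 2 * d" by blast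
        have "(SUP x. norm ((w x + v0 x) - u x)) \<le> 2 * d"
          using w(2) by (intro cSUP_least) (auto simp: algebra_simps)
        then show "\<exists>v\<in>E. (SUP x. norm (v x - u x)) < e"
          using e by (intro bexI[OF _ E_add[OF w(1) v0(1)]]) (simp add: d_def)
      qed
    qed
  qed
qed

end
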